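(* Let $1\le p<\infty$ and let $T\colon L^p[0,1]\to L^p[0,1]$ be a positive operator. The following statements are equivalent. (i) $T=MN-NM$ for some positive operators $M,N\colon L^p[0,1]\to L^p[0,1]$ with $M^2=N^2=0$. (ii) There exist positive operators $M,N\colon L^p[0,1]\to L^p[0,1]$ such that $T=MN$ and $M^2=N^2=NM=0$. (iii) There exists a positive operator $U\colon L^p[0,1]\to L^p[0,1]$ such that $T=U^2$ and $U^3=0$. (iv) There exists a nontrivial band decomposition $L^p[0,1]=B_1\oplus B_2\oplus B_3$ with respect to which the operator $T$ is of the form $$T=\begin{pmatrix} 0 & 0 & T_{13}\\ 0 & 0 & 0\\ 0 & 0 & 0\end{pmatrix}$$ for some positive operator $T_{13}\colon B_3\to B_1$.
   Context: $L^p[0,1]$ is the real Banach lattice of (classes of) $p$-integrable functions on $[0,1]$ with Lebesgue measure and the almost-everywhere pointwise order. A linear operator between vector lattices is positive if it maps the positive cone of the domain into the positive cone of the codomain. An ideal of a vector lattice $X$ is a subspace $A$ such that $|x|\le|y|$ and $y\in A$ imply $x\in A$; a band is an order closed ideal (in $L^p[0,1]$, $1\le p<\infty$, bands are precisely the norm closed ideals). A band decomposition $L^p[0,1]=B_1\oplus B_2\oplus B_3$ is a decomposition as a direct sum of (pairwise disjoint) bands; it is nontrivial if each of the bands $B_1,B_2,B_3$ is non-zero. *)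

theory Defs
  imports "HOL-Analysis.Analysis" "HOL-Library.Lattice_Algebras"
begin

section \<open>Bands and positive operators\<close>

text \<open>
  All notions below are relative to a carrier set \<open>X\<close>, which is a vector sublattice of the
  ambient vector lattice. This is needed because \<open>L\<^sup>p[0,1]\<close> depends on the real parameter
  \<open>p\<close> and so is a set rather than a type.
\<close>

class vector_lattice = ordered_real_vector + lattice_ab_group_add_abs

text \<open>Values of \<open>T\<close> outside \<open>X\<close> are irrelevant, so two operators on \<open>X\<close> are to be
  compared on \<open>X\<close> only.\<close>

definition positive_operator ::
    "'a::ordered_real_vector set \<Rightarrow> 'b::ordered_real_vector set \<Rightarrow> ('a \<Rightarrow> 'b) \<Rightarrow> bool" where
  "positive_operator X Y T \<longleftrightarrow>
     (\<forall>x\<in>X. T x \<in> Y) \<and>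
     (\<forall>x\<in>X. \<forall>y\<in>X. T (x + y) = T x + T y) \<and>
     (\<forall>c. \<forall>x\<in>X. T (c *\<^sub>R x) = c *\<^sub>R T x) \<and>
     (\<forall>x\<in>X. 0 \<le> x \<longrightarrow> 0 \<le> T x)"

definition ideal_in :: "'a::vector_lattice set \<Rightarrow> 'a set \<Rightarrow> bool" where
  "ideal_in X A \<longleftrightarrow>
     subspace A \<and> A \<subseteq> X \<and> (\<forall>x\<in>X. \<forall>y\<in>A. \<bar>x\<bar> \<le> \<bar>y\<bar> \<longrightarrow> x \<in> A)"

definition is_infimum_in :: "'a::order set \<Rightarrow> 'a set \<Rightarrow> 'a \<Rightarrow> bool" where
  "is_infimum_in X D z \<longleftrightarrow>
     z \<in> X \<and> (\<forall>d\<in>D. z \<le> d) \<and> (\<forall>w\<in>X. (\<forall>d\<in>D. w \<le> d) \<longrightarrow> w \<le> z)"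

definition directed_set :: "'i set \<Rightarrow> ('i \<Rightarrow> 'i \<Rightarrow> bool) \<Rightarrow> bool" where
  "directed_set I r \<longleftrightarrow>
     I \<noteq> {} \<and> (\<forall>i\<in>I. r i i) \<and>
     (\<forall>i\<in>I. \<forall>j\<in>I. \<forall>k\<in>I. r i j \<longrightarrow> r j k \<longrightarrow> r i k) \<and>
     (\<forall>i\<in>I. \<forall>j\<in>I. \<exists>k\<in>I. r i k \<and> r j k)"

text \<open>The net \<open>x\<close> converges in order to \<open>l\<close> if \<open>\<bar>x i - l\<bar> \<le> y i\<close> for some net \<open>y\<close> in \<open>X\<close>
  decreasing to \<open>0\<close>.\<close>

definition order_converges_in ::
    "'a::vector_lattice set \<Rightarrow> 'i set \<Rightarrow> ('i \<Rightarrow> 'i \<Rightarrow> bool) \<Rightarrow> ('i \<Rightarrow> 'a) \<Rightarrow> 'a \<Rightarrow> bool" where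
  "order_converges_in X I r x l \<longleftrightarrow>
     (\<exists>y. (\<forall>i\<in>I. y i \<in> X) \<and> (\<forall>i\<in>I. \<forall>j\<in>I. r i j \<longrightarrow> y j \<le> y i) \<and>
          is_infimum_in X (y ` I) 0 \<and> (\<forall>i\<in>I. \<bar>x i - l\<bar> \<le> y i))"

text \<open>
  Nets indexed by subsets of \<open>'a\<close> suffice: if \<open>\<bar>x i - l\<bar> \<le> y i\<close> with \<open>y\<close> decreasing to \<open>0\<close>,
  one may re-index by the set of all \<open>y i\<close>, directed by \<open>\<ge>\<close>, choosing for each \<open>d\<close> in it one
  index \<open>i\<close> with \<open>y i = d\<close>.
\<close>

definition order_closed_in :: "'a::vector_lattice set \<Rightarrow> 'a set \<Rightarrow> bool" where
  "order_closed_in X A \<longleftrightarrow>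
     (\<forall>(I :: 'a set) r x l.
        directed_set I r \<longrightarrow> (\<forall>i\<in>I. x i \<in> A) \<longrightarrow> l \<in> X \<longrightarrow> order_converges_in X I r x l \<longrightarrow> l \<in> A)"

definition band_in :: "'a::vector_lattice set \<Rightarrow> 'a set \<Rightarrow> bool" where
  "band_in X B \<longleftrightarrow> ideal_in X B \<and> order_closed_in X B"

definition disjoint_sets_in_lattice :: "'a::vector_lattice set \<Rightarrow> 'a set \<Rightarrow> bool" where
  "disjoint_sets_in_lattice A B \<longleftrightarrow> (\<forall>x\<in>A. \<forall>y\<in>B. inf \<bar>x\<bar> \<bar>y\<bar> = 0)"

definition band_decomposition3 ::
    "'a::vector_lattice set \<Rightarrow> 'a set \<Rightarrow> 'a set \<Rightarrow> 'a set \<Rightarrow> bool" where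
  "band_decomposition3 X B1 B2 B3 \<longleftrightarrow>
     band_in X B1 \<and> band_in X B2 \<and> band_in X B3 \<and>
     disjoint_sets_in_lattice B1 B2 \<and> disjoint_sets_in_lattice B1 B3 \<and>
     disjoint_sets_in_lattice B2 B3 \<and>
     (\<forall>x\<in>X. \<exists>!(x1, x2, x3). x1 \<in> B1 \<and> x2 \<in> B2 \<and> x3 \<in> B3 \<and> x = x1 + x2 + x3)"

definition nontrivial_band_decomposition3 ::
    "'a::vector_lattice set \<Rightarrow> 'a set \<Rightarrow> 'a set \<Rightarrow> 'a set \<Rightarrow> bool" where
  "nontrivial_band_decomposition3 X B1 B2 B3 \<longleftrightarrow>
     band_decomposition3 X B1 B2 B3 \<and> B1 \<noteq> {0} \<and> B2 \<noteq> {0} \<and> B3 \<noteq> {0}"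

section \<open>The vector lattice of measurable functions modulo almost everywhere equality\<close>

abbreviation unit_interval_measure :: "real measure" where
  "unit_interval_measure \<equiv> lebesgue_on {0..1}"

definition ae_equal :: "(real \<Rightarrow> real) \<Rightarrow> (real \<Rightarrow> real) \<Rightarrow> bool" where
  "ae_equal f g \<longleftrightarrow>
     f \<in> borel_measurable unit_interval_measure \<and> g \<in> borel_measurable unit_interval_measure \<and>
     (AE x in unit_interval_measure. f x = g x)"

quotient_type L0 = "real \<Rightarrow> real" / partial: ae_equal
  morphisms L0_rep L0_of
proof (rule part_equivpI)
  show "\<exists>f. ae_equal f f"
    by (rule exI[of _ "\<lambda>_. 0"]) (simp add: ae_equal_def)
  show "symp ae_equal"
    by (auto simp: symp_def ae_equal_def eq_commute)
  show "transp ae_equal"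
    unfolding transp_def ae_equal_def by (auto elim: eventually_elim2)
qed

instantiation L0 :: vector_lattice
begin

lift_definition zero_L0 :: L0 is "\<lambda>_. 0"
  by (simp add: ae_equal_def)

lift_definition plus_L0 :: "L0 \<Rightarrow> L0 \<Rightarrow> L0" is "\<lambda>f g x. f x + g x"
  unfolding ae_equal_def by (auto elim: eventually_elim2)

lift_definition minus_L0 :: "L0 \<Rightarrow> L0 \<Rightarrow> L0" is "\<lambda>f g x. f x - g x"
  unfolding ae_equal_def by (auto elim: eventually_elim2)

lift_definition uminus_L0 :: "L0 \<Rightarrow> L0" is "\<lambda>f x. - f x"
  unfolding ae_equal_def by auto

lift_definition scaleR_L0 :: "real \<Rightarrow> L0 \<Rightarrow> L0" is "\<lambda>c f x. c * f x"
  unfolding ae_equal_def by (auto elim: eventually_mono)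

lift_definition inf_L0 :: "L0 \<Rightarrow> L0 \<Rightarrow> L0" is "\<lambda>f g x. min (f x) (g x)"
  unfolding ae_equal_def by (auto elim: eventually_elim2)

lift_definition sup_L0 :: "L0 \<Rightarrow> L0 \<Rightarrow> L0" is "\<lambda>f g x. max (f x) (g x)"
  unfolding ae_equal_def by (auto elim: eventually_elim2)

lift_definition abs_L0 :: "L0 \<Rightarrow> L0" is "\<lambda>f x. \<bar>f x\<bar>"
  unfolding ae_equal_def by (auto elim: eventually_mono)

lift_definition less_eq_L0 :: "L0 \<Rightarrow> L0 \<Rightarrow> bool"
  is "\<lambda>f g. AE x in unit_interval_measure. f x \<le> g x"
proof -
  fix f f' g g' :: "real \<Rightarrow> real"
  assume "ae_equal f f'" "ae_equal g g'"
  then have "AE x in unit_interval_measure. f x = f' x \<and> g x = g' x"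
    by (simp add: ae_equal_def)
  then have "AE x in unit_interval_measure. (f x \<le> g x) = (f' x \<le> g' x)"
    by (auto elim: eventually_mono)
  then show "(AE x in unit_interval_measure. f x \<le> g x) =
      (AE x in unit_interval_measure. f' x \<le> g' x)"
    by (rule eventually_cong)
qed

definition less_L0 :: "L0 \<Rightarrow> L0 \<Rightarrow> bool" where
  "less_L0 f g \<longleftrightarrow> f \<le> g \<and> \<not> g \<le> f"

instance
proof
  fix a b c :: L0 and r s :: real
  show "a + b + c = a + (b + c)" "a + b = b + a" "0 + a = a" "- a + a = 0" "a - b = a + - b"
    "r *\<^sub>R (a + b) = r *\<^sub>R a + r *\<^sub>R b" "(r + s) *\<^sub>R a = r *\<^sub>R a + s *\<^sub>R a"
    "r *\<^sub>R s *\<^sub>R a = (r * s) *\<^sub>R a" "1 *\<^sub>R a = a"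
    by (transfer; force simp: ae_equal_def algebra_simps)+
  show "a < b \<longleftrightarrow> a \<le> b \<and> \<not> b \<le> a"
    by (rule less_L0_def)
  show "a \<le> a" "inf a b \<le> a" "inf a b \<le> b" "a \<le> sup a b" "b \<le> sup a b"
    by (transfer; simp)+
  show "a \<le> c" if "a \<le> b" "b \<le> c"
    using that by transfer (auto elim: eventually_elim2)
  show "a = b" if "a \<le> b" "b \<le> a"
    using that by transfer (auto simp: ae_equal_def elim: eventually_elim2)
  show "c + a \<le> c + b" if "a \<le> b"
    using that by transfer simp
  show "a \<le> inf b c" if "a \<le> b" "a \<le> c"
    using that by transfer (auto elim: eventually_elim2)
  show "sup b c \<le> a" if "b \<le> a" "c \<le> a"
    using that by transfer (auto elim: eventually_elim2)
  show "r *\<^sub>R a \<le> r *\<^sub>R b" if "a \<le> b" "0 \<le> r"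
    using that by transfer (auto elim!: eventually_mono intro: mult_left_mono)
  show "r *\<^sub>R a \<le> s *\<^sub>R a" if "r \<le> s" "0 \<le> a"
    using that by transfer (auto elim!: eventually_mono intro: mult_right_mono)
  show "\<bar>a\<bar> = sup a (- a)"
    by transfer (auto simp: ae_equal_def abs_real_def max_def intro!: always_eventually)
qed

end

text \<open>
  For \<open>p \<ge> 1\<close> the set \<open>Lp p\<close> below is an ideal of \<open>L0\<close>, so the order, suprema, infima and
  absolute values of \<open>L\<^sup>p[0,1]\<close> are those of \<open>L0\<close>. The norm is not needed: positive operators
  are automatically bounded, and bands are defined by order closedness.
\<close>

lift_definition p_integrable :: "real \<Rightarrow> L0 \<Rightarrow> bool"
  is "\<lambda>p f. integrable unit_interval_measure (\<lambda>x. \<bar>f x\<bar> powr p)"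
  unfolding ae_equal_def
  by (intro integrable_cong_AE) (auto elim: eventually_mono)

definition Lp :: "real \<Rightarrow> L0 set" where
  "Lp p = {f. p_integrable p f}"

end

(* A positive operator S on L^p has an absolute kernel N(S) = {f. S |f| = 0}, which is a band. If
   T T = S T = 0, T is non-zero and N(T) is not contained in N(S), then the bands N(T) \<inter> N(S), its
   complement in N(T), and the complement of N(T) form a decomposition as in (iv). Under (iii) take
   S = U. Under (i), positivity of T gives N M \<le> M N, so M N M \<le> M M N = 0 and N M N \<le> M N N = 0;
   hence M T = N T = T N = 0 and S = M + N works. For the converse, a non-zero band B2 contains a
   band L^p(E) with E of positive measure, which is isomorphic to L^p[0,1] through the distribution
   function of E; so any operator from B3 to B1 factors through B2. *)

theory Submission
  imports Defs "HOL-Probability.Weak_Convergence"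
begin

subsection \<open>Borel representatives\<close>

text \<open>The delicate requirement in (iv) is that the middle band is non-zero: a non-zero
  \<open>T\<close> with \<open>T T = 0\<close> need not leave room for it, as when \<open>T\<close>
  maps one half of the interval isomorphically onto the other. The room comes from a function killed
  by \<open>T\<close> but not by \<open>S\<close>. One of the given factors supplies it:
  \<open>U f\<close> under (iii) and \<open>N f\<close> under (i), where \<open>T f\<close> is
  non-zero and \<open>f\<close> is non-negative. For \<open>T = 0\<close> the complement of the
  kernel is zero, so a decomposition is chosen by hand. That an absolute kernel is a band rests on
  order continuity of positive operators on \<open>Lp p\<close>. This follows from the classical
  argument for their automatic boundedness, phrased here with integrals of p-th powers. In the
  converse direction the middle band may be far smaller than the third one. This is harmless because
  Lebesgue measure has no atoms, so even a tiny set of positive measure carries a copy of the whole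
  space.\<close>

lemma AE_unit_interval_iff:
  "(AE x in unit_interval_measure. P x) \<longleftrightarrow> (AE x in lborel. x \<in> {0..1} \<longrightarrow> P x)"
  by (subst AE_restrict_space_iff) (auto simp: AE_completion_iff)

lemma borel_measurable_unit_interval:
  "g \<in> borel_measurable borel \<Longrightarrow> g \<in> borel_measurable unit_interval_measure"
  by (intro measurable_restrict_space1 measurable_completion) simp

lemma L0_of_eq_iff:
  assumes "f \<in> borel_measurable unit_interval_measure" "g \<in> borel_measurable unit_interval_measure"
  shows "L0_of f = L0_of g \<longleftrightarrow> (AE x in unit_interval_measure. f x = g x)"
  using Quotient3_rel[OF Quotient3_L0, of f g] assms by (auto simp: ae_equal_def)

lemma ae_equal_refl: "f \<in> borel_measurable unit_interval_measure \<Longrightarrow> ae_equal f f"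
  by (simp add: ae_equal_def)

lemma ex_borel_representative: "\<exists>g\<in>borel_measurable borel. f = L0_of g"
proof -
  define r where "r = L0_rep f"
  have r: "r \<in> borel_measurable unit_interval_measure" "L0_of r = f"
    using Quotient3_rep_reflp[OF Quotient3_L0, of f] Quotient3_abs_rep[OF Quotient3_L0, of f]
    by (auto simp: ae_equal_def r_def)
  have "(\<lambda>x. r x * indicator {0..1} x) \<in> borel_measurable lebesgue"
    using r(1) by (subst (asm) borel_measurable_restrict_space_iff) (auto simp: mult.commute)
  then obtain g where g: "g \<in> borel_measurable lborel" "AE x in lborel. r x * indicator {0..1} x = g x"
    using completion_ex_borel_measurable_real by blast
  have "AE x in unit_interval_measure. r x = g x"
    unfolding AE_unit_interval_iff using g(2) by eventually_elim auto
  moreover have "g \<in> borel_measurable borel"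
    using g(1) by simp
  ultimately show ?thesis
    using r L0_of_eq_iff[of r g] borel_measurable_unit_interval by blast
qed

text \<open>Representatives are chosen Borel rather than merely Lebesgue measurable: the composition
  of a Lebesgue measurable function with a Borel function \<open>\<phi>\<close> can fail to be
  measurable, and the embedding built later is such a composition.\<close>

definition rep :: "L0 \<Rightarrow> real \<Rightarrow> real" where
  "rep f = (SOME g. g \<in> borel_measurable borel \<and> f = L0_of g)"

lemma rep_measurable[measurable]: "rep f \<in> borel_measurable borel"
  and L0_of_rep: "L0_of (rep f) = f"
proof -
  have "\<exists>g. g \<in> borel_measurable borel \<and> f = L0_of g"
    using ex_borel_representative[of f] by blast
  from someI_ex[OF this] show "rep f \<in> borel_measurable borel" "L0_of (rep f) = f"
    unfolding rep_def[symmetric] by simp_all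
qed

lemmas rep_measurable_unit[measurable] = borel_measurable_unit_interval[OF rep_measurable]

lemma rep_L0_of:
  assumes "g \<in> borel_measurable unit_interval_measure"
  shows "AE x in unit_interval_measure. rep (L0_of g) x = g x"
  using L0_of_eq_iff[of "rep (L0_of g)" g] assms by (simp add: L0_of_rep)

lemma L0_eq_iff: "f = g \<longleftrightarrow> (AE x in unit_interval_measure. rep f x = rep g x)"
  using L0_of_eq_iff[of "rep f" "rep g"] by (simp add: L0_of_rep)

lemma L0_le_iff: "f \<le> g \<longleftrightarrow> (AE x in unit_interval_measure. rep f x \<le> rep g x)"
  using less_eq_L0.abs_eq[of "rep f" "rep g"] by (simp add: L0_of_rep ae_equal_refl)

lemma rep_zero: "AE x in unit_interval_measure. rep 0 x = 0"
  unfolding zero_L0_def by (rule rep_L0_of) simp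

lemma rep_plus: "AE x in unit_interval_measure. rep (f + g) x = rep f x + rep g x"
  using plus_L0.abs_eq[of "rep f" "rep g"] rep_L0_of[of "\<lambda>x. rep f x + rep g x"]
  by (simp add: L0_of_rep ae_equal_refl)

lemma rep_minus: "AE x in unit_interval_measure. rep (f - g) x = rep f x - rep g x"
  using minus_L0.abs_eq[of "rep f" "rep g"] rep_L0_of[of "\<lambda>x. rep f x - rep g x"]
  by (simp add: L0_of_rep ae_equal_refl)

lemma rep_scaleR: "AE x in unit_interval_measure. rep (c *\<^sub>R f) x = c * rep f x"
  using scaleR_L0.abs_eq[of "rep f" c] rep_L0_of[of "\<lambda>x. c * rep f x"]
  by (simp add: L0_of_rep ae_equal_refl)

lemma rep_abs: "AE x in unit_interval_measure. rep \<bar>f\<bar> x = \<bar>rep f x\<bar>"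
  using abs_L0.abs_eq[of "rep f"] rep_L0_of[of "\<lambda>x. \<bar>rep f x\<bar>"]
  by (simp add: L0_of_rep ae_equal_refl)

lemma rep_inf: "AE x in unit_interval_measure. rep (inf f g) x = min (rep f x) (rep g x)"
  using inf_L0.abs_eq[of "rep f" "rep g"] rep_L0_of[of "\<lambda>x. min (rep f x) (rep g x)"]
  by (simp add: L0_of_rep ae_equal_refl)

lemma nonneg_L0_iff: "0 \<le> f \<longleftrightarrow> (AE x in unit_interval_measure. 0 \<le> rep f x)"
  unfolding L0_le_iff using rep_zero by (intro eventually_cong[OF rep_zero]) auto

lemma zero_L0_iff: "f = 0 \<longleftrightarrow> (AE x in unit_interval_measure. rep f x = 0)"
  unfolding L0_eq_iff[of f 0] by (intro eventually_cong[OF rep_zero]) auto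

lemma abs_le_L0_iff: "\<bar>f\<bar> \<le> \<bar>g\<bar> \<longleftrightarrow> (AE x in unit_interval_measure. \<bar>rep f x\<bar> \<le> \<bar>rep g x\<bar>)"
proof -
  have "AE x in unit_interval_measure. rep \<bar>f\<bar> x \<le> rep \<bar>g\<bar> x \<longleftrightarrow> \<bar>rep f x\<bar> \<le> \<bar>rep g x\<bar>"
    using rep_abs[of f] rep_abs[of g] by eventually_elim simp
  then show ?thesis unfolding L0_le_iff by (rule eventually_cong) simp
qed

section \<open>The sets \<open>Lp p\<close> as vector sublattices\<close>

lemma Lp_iff: "f \<in> Lp p \<longleftrightarrow> integrable unit_interval_measure (\<lambda>x. \<bar>rep f x\<bar> powr p)"
  using p_integrable.abs_eq[of "rep f" p] by (simp add: Lp_def L0_of_rep ae_equal_refl)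

lemma L0_of_in_Lp_iff:
  "g \<in> borel_measurable unit_interval_measure \<Longrightarrow>
    L0_of g \<in> Lp p \<longleftrightarrow> integrable unit_interval_measure (\<lambda>x. \<bar>g x\<bar> powr p)"
  using p_integrable.abs_eq[of g p] by (simp add: Lp_def ae_equal_refl)

lemma Lp_bounded:
  assumes "f \<in> Lp p" "0 \<le> p" "AE x in unit_interval_measure. \<bar>rep g x\<bar> \<le> c * \<bar>rep f x\<bar>" "0 \<le> c"
  shows "g \<in> Lp p"
  unfolding Lp_iff
proof (rule Bochner_Integration.integrable_bound)
  show "integrable unit_interval_measure (\<lambda>x. c powr p * \<bar>rep f x\<bar> powr p)"
    using assms(1) by (simp add: Lp_iff)
  show "AE x in unit_interval_measure. norm (\<bar>rep g x\<bar> powr p) \<le> norm (c powr p * \<bar>rep f x\<bar> powr p)"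
    using assms(3)
  proof eventually_elim
    case (elim x)
    then have "\<bar>rep g x\<bar> powr p \<le> (c * \<bar>rep f x\<bar>) powr p"
      using assms by (intro powr_mono2) auto
    then show ?case using assms by (simp add: powr_mult)
  qed
qed measurable

lemma Lp_solid: "f \<in> Lp p \<Longrightarrow> 0 \<le> p \<Longrightarrow> \<bar>g\<bar> \<le> \<bar>f\<bar> \<Longrightarrow> g \<in> Lp p"
  unfolding abs_le_L0_iff by (rule Lp_bounded[where c = 1]) auto

lemma Lp_scaleR: "f \<in> Lp p \<Longrightarrow> 0 \<le> p \<Longrightarrow> c *\<^sub>R f \<in> Lp p"
  by (rule Lp_bounded[where c = "\<bar>c\<bar>"], assumption+)
    (use rep_scaleR[of c f] in \<open>eventually_elim, simp add: abs_mult\<close>, simp)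

lemma Lp_plus:
  assumes "f \<in> Lp p" "g \<in> Lp p" "0 \<le> p"
  shows "f + g \<in> Lp p"
  unfolding Lp_iff
proof (rule Bochner_Integration.integrable_bound)
  show "integrable unit_interval_measure (\<lambda>x. 2 powr p * (\<bar>rep f x\<bar> powr p + \<bar>rep g x\<bar> powr p))"
    using assms by (simp add: Lp_iff)
  show "AE x in unit_interval_measure. norm (\<bar>rep (f + g) x\<bar> powr p) \<le>
      norm (2 powr p * (\<bar>rep f x\<bar> powr p + \<bar>rep g x\<bar> powr p))"
    using rep_plus[of f g]
  proof eventually_elim
    case (elim x)
    \<comment> \<open>Bounding the sum by twice the maximum replaces convexity of the p-th power and
      covers all \<open>p \<ge> 0\<close>.\<close>
    have "\<bar>rep (f + g) x\<bar> powr p \<le> (2 * max \<bar>rep f x\<bar> \<bar>rep g x\<bar>) powr p"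
      using assms by (intro powr_mono2) (auto simp: elim max_def)
    also have "\<dots> = 2 powr p * (max \<bar>rep f x\<bar> \<bar>rep g x\<bar>) powr p"
      by (simp add: powr_mult)
    also have "\<dots> \<le> 2 powr p * (\<bar>rep f x\<bar> powr p + \<bar>rep g x\<bar> powr p)"
      by (intro mult_left_mono) (auto simp: max_def)
    finally show ?case by simp
  qed
qed measurable

lemma zero_in_Lp: "0 \<in> Lp p"
  unfolding zero_L0_def by (subst L0_of_in_Lp_iff) auto

lemma subspace_Lp: "0 \<le> p \<Longrightarrow> subspace (Lp p)"
  by (auto simp: subspace_def zero_in_Lp Lp_plus Lp_scaleR)

lemma Lp_abs: "f \<in> Lp p \<Longrightarrow> 0 \<le> p \<Longrightarrow> \<bar>f\<bar> \<in> Lp p"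
  by (erule Lp_solid) auto

lemma Lp_minus: "f \<in> Lp p \<Longrightarrow> g \<in> Lp p \<Longrightarrow> 0 \<le> p \<Longrightarrow> f - g \<in> Lp p"
  using subspace_diff[OF subspace_Lp] by blast

subsection \<open>Bands and positive operators\<close>

text \<open>The set \<open>A\<close> ranges over subsets of the whole line, although only its part
  in \<open>{0..1}\<close> matters. So \<open>- A\<close> can stand for the complementary band, and
  a decomposition corresponds to a partition of \<open>UNIV\<close>.\<close>

definition Lp_on :: "real \<Rightarrow> real set \<Rightarrow> L0 set" where
  "Lp_on p A = {f \<in> Lp p. AE x in unit_interval_measure. x \<notin> A \<longrightarrow> rep f x = 0}"

text \<open>This is the band projection onto \<open>Lp_on p A\<close>.\<close>

definition cut :: "real set \<Rightarrow> L0 \<Rightarrow> L0" where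
  "cut A f = L0_of (\<lambda>x. indicator A x * rep f x)"

lemma rep_cut:
  "A \<in> sets borel \<Longrightarrow> AE x in unit_interval_measure. rep (cut A f) x = indicator A x * rep f x"
  unfolding cut_def
  by (intro rep_L0_of borel_measurable_unit_interval borel_measurable_times
      borel_measurable_indicator rep_measurable)

lemma cut_in_Lp_on:
  assumes "f \<in> Lp p" "0 \<le> p" "A \<in> sets borel"
  shows "cut A f \<in> Lp_on p A"
proof -
  have "AE x in unit_interval_measure. \<bar>rep (cut A f) x\<bar> \<le> 1 * \<bar>rep f x\<bar>"
    using rep_cut[OF assms(3), of f] by eventually_elim (simp add: indicator_def)
  then have "cut A f \<in> Lp p"
    using Lp_bounded[OF assms(1,2), of _ 1] by simp
  moreover have "AE x in unit_interval_measure. x \<notin> A \<longrightarrow> rep (cut A f) x = 0"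
    using rep_cut[OF assms(3), of f] by eventually_elim simp
  ultimately show ?thesis by (simp add: Lp_on_def)
qed

lemma ideal_in_Lp_on:
  assumes "0 \<le> p"
  shows "ideal_in (Lp p) (Lp_on p A)"
  unfolding ideal_in_def
proof (intro conjI ballI impI)
  show "subspace (Lp_on p A)"
    unfolding subspace_def Lp_on_def
  proof (intro conjI ballI allI CollectI; (elim CollectE conjE)?)
    show "AE x in unit_interval_measure. x \<notin> A \<longrightarrow> rep 0 x = 0"
      using rep_zero by eventually_elim simp
    show "AE x in unit_interval_measure. x \<notin> A \<longrightarrow> rep (f + g) x = 0"
      if "AE x in unit_interval_measure. x \<notin> A \<longrightarrow> rep f x = 0"
        "AE x in unit_interval_measure. x \<notin> A \<longrightarrow> rep g x = 0" for f g
      using that rep_plus[of f g] by eventually_elim simp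
    show "AE x in unit_interval_measure. x \<notin> A \<longrightarrow> rep (c *\<^sub>R f) x = 0"
      if "AE x in unit_interval_measure. x \<notin> A \<longrightarrow> rep f x = 0" for c f
      using that rep_scaleR[of c f] by eventually_elim simp
  qed (use assms in \<open>simp_all add: zero_in_Lp Lp_plus Lp_scaleR\<close>)
  show "Lp_on p A \<subseteq> Lp p"
    by (auto simp: Lp_on_def)
  fix f g assume f: "f \<in> Lp p" and g: "g \<in> Lp_on p A" and "\<bar>f\<bar> \<le> \<bar>g\<bar>"
  have "AE x in unit_interval_measure. x \<notin> A \<longrightarrow> rep g x = 0"
    using g by (simp add: Lp_on_def)
  then have "AE x in unit_interval_measure. x \<notin> A \<longrightarrow> rep f x = 0"
    using \<open>\<bar>f\<bar> \<le> \<bar>g\<bar>\<close>[unfolded abs_le_L0_iff] by eventually_elim auto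
  with f show "f \<in> Lp_on p A" by (simp add: Lp_on_def)
qed

text \<open>For order closedness: the net vanishes off \<open>A\<close>, so there
  \<open>\<bar>x i - l\<bar>\<close> is just \<open>\<bar>l\<bar>\<close>. The part \<open>w\<close>
  of \<open>\<bar>l\<bar>\<close> off \<open>A\<close> is therefore a lower bound of all
  \<open>y i\<close>, whose infimum is 0.\<close>

lemma band_in_Lp_on:
  assumes p: "0 \<le> p" and A: "A \<in> sets borel"
  shows "band_in (Lp p) (Lp_on p A)"
  unfolding band_in_def order_closed_in_def
proof (intro conjI allI impI ideal_in_Lp_on p)
  fix I :: "L0 set" and r x l
  assume x: "\<forall>i\<in>I. x i \<in> Lp_on p A" and l: "l \<in> Lp p" and "order_converges_in (Lp p) I r x l"
  then obtain y where inf: "is_infimum_in (Lp p) (y ` I) 0" and y: "\<forall>i\<in>I. \<bar>x i - l\<bar> \<le> y i"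
    by (auto simp: order_converges_in_def)
  define w where "w = cut (- A) \<bar>l\<bar>"
  have w: "AE t in unit_interval_measure. rep w t = indicator (- A) t * \<bar>rep l t\<bar>"
    using rep_cut[of "- A" "\<bar>l\<bar>"] rep_abs[of l] A unfolding w_def by fastforce
  have "w \<le> y i" if "i \<in> I" for i
  proof -
    have "AE t in unit_interval_measure. t \<notin> A \<longrightarrow> rep (x i) t = 0"
      using x that by (auto simp: Lp_on_def)
    moreover have "AE t in unit_interval_measure. rep \<bar>x i - l\<bar> t \<le> rep (y i) t"
      using y that by (simp add: L0_le_iff)
    ultimately have "AE t in unit_interval_measure. rep w t \<le> rep (y i) t"
      using w rep_abs[of "x i - l"] rep_minus[of "x i" l]
      by eventually_elim (auto simp: indicator_def split: if_splits)
    then show ?thesis by (simp add: L0_le_iff)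
  qed
  moreover have "w \<in> Lp p"
    using cut_in_Lp_on[of "\<bar>l\<bar>" p "- A"] Lp_abs[OF l p] p A by (auto simp: w_def Lp_on_def)
  ultimately have "w \<le> 0"
    using inf by (auto simp: is_infimum_in_def)
  then have "AE t in unit_interval_measure. rep w t \<le> rep 0 t"
    by (simp add: L0_le_iff)
  then have "AE t in unit_interval_measure. t \<notin> A \<longrightarrow> rep l t = 0"
    using w rep_zero by eventually_elim auto
  with l show "l \<in> Lp_on p A" by (simp add: Lp_on_def)
qed

lemma disjoint_Lp_on:
  assumes "A \<inter> B = {}"
  shows "disjoint_sets_in_lattice (Lp_on p A) (Lp_on p B)"
  unfolding disjoint_sets_in_lattice_def
proof (intro ballI)
  fix f g assume "f \<in> Lp_on p A" "g \<in> Lp_on p B"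
  then have "AE x in unit_interval_measure. x \<notin> A \<longrightarrow> rep f x = 0"
    "AE x in unit_interval_measure. x \<notin> B \<longrightarrow> rep g x = 0"
    by (auto simp: Lp_on_def)
  then have "AE x in unit_interval_measure. rep (inf \<bar>f\<bar> \<bar>g\<bar>) x = 0"
    using rep_inf[of "\<bar>f\<bar>" "\<bar>g\<bar>"] rep_abs[of f] rep_abs[of g]
    by eventually_elim (use assms in auto)
  then show "inf \<bar>f\<bar> \<bar>g\<bar> = 0" by (simp add: zero_L0_iff)
qed

lemma band_decomposition3_Lp_on:
  assumes p: "0 \<le> p" and A: "A \<in> sets borel" "B \<in> sets borel" "C \<in> sets borel"
    and disj: "A \<inter> B = {}" "A \<inter> C = {}" "B \<inter> C = {}" and un: "A \<union> B \<union> C = UNIV"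
  shows "band_decomposition3 (Lp p) (Lp_on p A) (Lp_on p B) (Lp_on p C)"
  unfolding band_decomposition3_def
proof (intro conjI ballI disjoint_Lp_on band_in_Lp_on assms)
  fix f assume f: "f \<in> Lp p"
  have "f = cut A f + cut B f + cut C f"
    unfolding L0_eq_iff
    using rep_plus[of "cut A f + cut B f" "cut C f"] rep_plus[of "cut A f" "cut B f"]
      rep_cut[OF A(1), of f] rep_cut[OF A(2), of f] rep_cut[OF A(3), of f]
    by eventually_elim (use disj un in \<open>auto simp: indicator_def\<close>)
  moreover have "g = cut A f \<and> h = cut B f \<and> k = cut C f"
    if "g \<in> Lp_on p A" "h \<in> Lp_on p B" "k \<in> Lp_on p C" "f = g + h + k" for g h k
  proof -
    have ae: "AE x in unit_interval_measure. x \<notin> A \<longrightarrow> rep g x = 0"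
      "AE x in unit_interval_measure. x \<notin> B \<longrightarrow> rep h x = 0"
      "AE x in unit_interval_measure. x \<notin> C \<longrightarrow> rep k x = 0"
      using that by (auto simp: Lp_on_def)
    have f: "AE x in unit_interval_measure. rep f x = rep g x + rep h x + rep k x"
      using rep_plus[of "g + h" k] rep_plus[of g h] unfolding that(4) by eventually_elim simp
    have "g = cut A f"
      unfolding L0_eq_iff using ae f rep_cut[OF A(1), of f]
      by eventually_elim (use disj in \<open>auto simp: indicator_def\<close>)
    moreover have "h = cut B f"
      unfolding L0_eq_iff using ae f rep_cut[OF A(2), of f]
      by eventually_elim (use disj in \<open>auto simp: indicator_def\<close>)
    moreover have "k = cut C f"
      unfolding L0_eq_iff using ae f rep_cut[OF A(3), of f]
      by eventually_elim (use disj in \<open>auto simp: indicator_def\<close>)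
    ultimately show ?thesis by blast
  qed
  ultimately show "\<exists>!(g, h, k). g \<in> Lp_on p A \<and> h \<in> Lp_on p B \<and> k \<in> Lp_on p C \<and> f = g + h + k"
    using cut_in_Lp_on[OF f p] A by (intro ex1I[of _ "(cut A f, cut B f, cut C f)"]) auto
qed

section \<open>Calculus of positive operators on carrier sets\<close>

lemma positive_operatorD:
  assumes "positive_operator X Y S" "x \<in> X"
  shows "S x \<in> Y" "y \<in> X \<Longrightarrow> S (x + y) = S x + S y" "S (c *\<^sub>R x) = c *\<^sub>R S x" "0 \<le> x \<Longrightarrow> 0 \<le> S x"
  using assms by (auto simp: positive_operator_def)

lemma positive_operator_zero: "positive_operator X Y S \<Longrightarrow> subspace X \<Longrightarrow> S 0 = 0"
  using positive_operatorD(3)[of X Y S 0 0] subspace_0[of X] by simp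

lemma positive_operator_diff:
  assumes "positive_operator X Y S" "subspace X" "x \<in> X" "y \<in> X"
  shows "S (x - y) = S x - S y"
proof -
  have "S (x - y + y) = S (x - y) + S y"
    using positive_operatorD(2)[OF assms(1) subspace_diff[OF assms(2-4)] assms(4)] .
  then show ?thesis by (simp add: algebra_simps)
qed

lemma positive_operator_mono:
  assumes "positive_operator X Y S" "subspace X" "x \<in> X" "y \<in> X" "x \<le> y"
  shows "S x \<le> S y"
  using positive_operator_diff[OF assms(1,2), of y x] positive_operatorD(4)[OF assms(1), of "y - x"]
    assms subspace_diff[of X y x] by simp

lemma positive_operator_abs_le:
  fixes S :: "'a::vector_lattice \<Rightarrow> 'b::vector_lattice"
  assumes "positive_operator X Y S" "subspace X" "x \<in> X" "\<bar>x\<bar> \<in> X"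
  shows "\<bar>S x\<bar> \<le> S \<bar>x\<bar>"
proof (rule abs_leI)
  show "S x \<le> S \<bar>x\<bar>"
    by (intro positive_operator_mono[OF assms] abs_ge_self)
  have "S (- x) \<le> S \<bar>x\<bar>"
    by (intro positive_operator_mono[OF assms(1,2) subspace_neg[OF assms(2,3)] assms(4)]
        abs_ge_minus_self)
  then show "- S x \<le> S \<bar>x\<bar>"
    using positive_operatorD(3)[OF assms(1,3), of "-1"] by simp
qed

lemma positive_operator_eq_zero_of_abs:
  fixes S :: "'a::vector_lattice \<Rightarrow> 'b::vector_lattice"
  assumes "positive_operator X Y S" "subspace X" "x \<in> X" "\<bar>x\<bar> \<in> X" "S \<bar>x\<bar> = 0"
  shows "S x = 0"
  using positive_operator_abs_le[OF assms(1-4)] assms(5) by simp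

lemma positive_operator_eq_zero_of_nonneg:
  fixes S :: "'a::vector_lattice \<Rightarrow> 'b::vector_lattice"
  assumes "positive_operator X Y S" "subspace X" "\<And>x. x \<in> X \<Longrightarrow> \<bar>x\<bar> \<in> X"
    and "\<And>x. x \<in> X \<Longrightarrow> 0 \<le> x \<Longrightarrow> S x = 0" "x \<in> X"
  shows "S x = 0"
  by (intro positive_operator_eq_zero_of_abs[OF assms(1,2,5)] assms(3,4) assms(5) abs_ge_zero)

lemma positive_operator_add:
  assumes "positive_operator X Y S" "positive_operator X Y T" "subspace Y"
  shows "positive_operator X Y (\<lambda>x. S x + T x)"
  using assms by (auto simp: positive_operator_def subspace_def algebra_simps)

lemma positive_operator_compose:
  assumes "positive_operator X Y S" "positive_operator Y Z T"
  shows "positive_operator X Z (\<lambda>x. T (S x))"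
  using assms by (auto simp: positive_operator_def)

lemma positive_operator_subset:
  assumes "positive_operator X Y S" "X' \<subseteq> X" "\<And>x. x \<in> X' \<Longrightarrow> S x \<in> Y'"
  shows "positive_operator X' Y' S"
  using assms by (auto simp: positive_operator_def subset_iff)

subsection \<open>Absolute kernels\<close>

text \<open>This plays the role of norm continuity of \<open>S\<close>. If the claim failed, a
  subsequence tending to 0 fast enough could be blown up by the factors \<open>k + 1\<close> and
  still be dominated by a single element of \<open>Lp p\<close>. The image of that element would lie
  above every multiple of \<open>h\<close>, contradicting the Archimedean property of the reals at
  almost every point.\<close>

lemma positive_operator_null_sequence:
  assumes p: "1 \<le> p" and S: "positive_operator (Lp p) (Lp p) S"
    and f: "\<And>n. f n \<in> Lp p" "\<And>n. 0 \<le> f n"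
    and lim: "(\<lambda>n. \<integral>x. \<bar>rep (f n) x\<bar> powr p \<partial>unit_interval_measure) \<longlonglongrightarrow> 0"
    and h: "\<And>n. h \<le> S (f n)"
  shows "h \<le> 0"
proof -
  let ?\<mu> = unit_interval_measure
  have sub: "subspace (Lp p)" using p by (simp add: subspace_Lp)
  \<comment> \<open>The denominator absorbs the later scaling by \<open>k + 1\<close>, which enters
    the integral as a p-th power. The remaining \<open>(1/2)^k\<close> makes the integrals
    summable.\<close>
  have "\<exists>n. (\<integral>x. \<bar>rep (f n) x\<bar> powr p \<partial>?\<mu>) < (1/2)^k / real (Suc k) powr p" for k
    using order_tendstoD(2)[OF lim, of "(1/2)^k / real (Suc k) powr p"]
    by (auto dest!: eventually_happens)
  then obtain r where r: "\<And>k. (\<integral>x. \<bar>rep (f (r k)) x\<bar> powr p \<partial>?\<mu>) < (1/2)^k / real (Suc k) powr p"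
    by metis
  define u where "u k x = real (Suc k) powr p * \<bar>rep (f (r k)) x\<bar> powr p" for k x
  have u_meas[measurable]: "u k \<in> borel_measurable ?\<mu>" for k
    unfolding u_def by measurable
  have u_int: "integrable ?\<mu> (u k)" for k
    using f(1)[of "r k"] unfolding u_def by (simp add: Lp_iff)
  have u_nonneg: "0 \<le> u k x" for k x by (simp add: u_def)
  have u_le: "(\<integral>x. u k x \<partial>?\<mu>) \<le> (1/2)^k" for k
    using r[of k] unfolding u_def by (simp add: field_simps)
  define G where "G x = (\<Sum>k. ennreal (u k x))" for x
  have G_meas[measurable]: "G \<in> borel_measurable ?\<mu>"
    unfolding G_def by measurable
  have "(\<integral>\<^sup>+x. G x \<partial>?\<mu>) = (\<Sum>k. \<integral>\<^sup>+x. ennreal (u k x) \<partial>?\<mu>)"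
    unfolding G_def by (rule nn_integral_suminf) measurable
  also have "\<dots> = (\<Sum>k. ennreal (\<integral>x. u k x \<partial>?\<mu>))"
    using u_int u_nonneg by (simp add: nn_integral_eq_integral)
  also have "\<dots> \<le> (\<Sum>k. ennreal ((1/2)^k))"
    using u_le by (intro suminf_le) (auto intro: ennreal_leI)
  also have "\<dots> = ennreal (\<Sum>k. (1/2)^k)"
    by (intro suminf_ennreal2) (auto intro: summable_geometric)
  also have "\<dots> < \<infinity>" by simp
  finally have G_fin: "(\<integral>\<^sup>+x. G x \<partial>?\<mu>) < \<infinity>" .
  then have G_AE: "AE x in ?\<mu>. G x \<noteq> \<infinity>"
    by (intro nn_integral_PInf_AE) auto
  \<comment> \<open>By construction \<open>g \<ge> (k + 1) f (r k)\<close> for every \<open>k\<close>, so \<open>S g\<close> dominates all multiples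
    of \<open>h\<close>.\<close>
  define g where "g = L0_of (\<lambda>x. enn2real (G x) powr (1/p))"
  have g_meas: "(\<lambda>x. enn2real (G x) powr (1/p)) \<in> borel_measurable ?\<mu>" by measurable
  \<comment> \<open>\<open>enn2real\<close> turns the value infinity into 0. By \<open>G_AE\<close>
    this changes \<open>G\<close> only on a null set.\<close>
  have "integrable ?\<mu> (\<lambda>x. enn2real (G x))"
  proof (rule integrableI_nonneg)
    have "(\<integral>\<^sup>+x. ennreal (enn2real (G x)) \<partial>?\<mu>) \<le> (\<integral>\<^sup>+x. G x \<partial>?\<mu>)"
      by (intro nn_integral_mono) (metis enn2real_top ennreal_enn2real_if order_refl zero_le)
    then show "(\<integral>\<^sup>+x. ennreal (enn2real (G x)) \<partial>?\<mu>) < \<infinity>"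
      using G_fin by (rule le_less_trans)
  qed auto
  moreover have "\<bar>enn2real (G x) powr (1/p)\<bar> powr p = enn2real (G x)" for x
    using p by (simp add: powr_powr)
  ultimately have g: "g \<in> Lp p"
    unfolding g_def by (subst L0_of_in_Lp_iff[OF g_meas]) simp
  have le: "real (Suc k) *\<^sub>R h \<le> S g" for k
  proof -
    have "AE x in ?\<mu>. rep (real (Suc k) *\<^sub>R f (r k)) x \<le> rep g x"
      using G_AE rep_L0_of[OF g_meas] rep_scaleR[of "real (Suc k)" "f (r k)"]
    proof eventually_elim
      case (elim x)
      have "ennreal (u k x) \<le> G x"
        unfolding G_def using sum_le_suminf[of "\<lambda>k. ennreal (u k x)" "{k}"] by simp
      then have "u k x \<le> enn2real (G x)"
        using elim(1) u_nonneg[of k x] by (metis enn2real_ennreal enn2real_mono infinity_ennreal_def top.not_eq_extremum)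
      then have "u k x powr (1/p) \<le> enn2real (G x) powr (1/p)"
        using p u_nonneg by (intro powr_mono2) auto
      moreover have "u k x powr (1/p) = real (Suc k) * \<bar>rep (f (r k)) x\<bar>"
        using p by (simp add: u_def powr_mult powr_powr)
      moreover have "real (Suc k) * rep (f (r k)) x \<le> real (Suc k) * \<bar>rep (f (r k)) x\<bar>"
        by (intro mult_left_mono) auto
      ultimately show ?case using elim(2,3) unfolding g_def by linarith
    qed
    then have "real (Suc k) *\<^sub>R f (r k) \<le> g"
      by (simp add: L0_le_iff)
    then have "S (real (Suc k) *\<^sub>R f (r k)) \<le> S g"
      using positive_operator_mono[OF S sub] Lp_scaleR[OF f(1)] g p by simp
    moreover have "real (Suc k) *\<^sub>R h \<le> real (Suc k) *\<^sub>R S (f (r k))"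
      by (intro scaleR_left_mono h) simp
    ultimately show ?thesis
      using positive_operatorD(3)[OF S f(1)] by (metis order_trans)
  qed
  have "AE x in ?\<mu>. real (Suc k) * rep h x \<le> rep (S g) x" for k
    using le[of k, unfolded L0_le_iff] rep_scaleR[of "real (Suc k)" h] by eventually_elim simp
  then have "AE x in ?\<mu>. \<forall>k. real (Suc k) * rep h x \<le> rep (S g) x"
    by (simp add: AE_all_countable)
  then have "AE x in ?\<mu>. rep h x \<le> rep 0 x"
    using rep_zero
  proof eventually_elim
    case (elim x)
    show ?case
    proof (rule ccontr)
      assume "\<not> ?thesis"
      with elim(2) have "0 < rep h x" by simp
      then obtain n where "rep (S g) x < real n * rep h x"
        using reals_Archimedean3 by blast
      also have "\<dots> \<le> real (Suc n) * rep h x"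
        using \<open>0 < rep h x\<close> by (intro mult_right_mono) auto
      finally show False using elim(1) by (metis not_le)
    qed
  qed
  then show ?thesis by (simp add: L0_le_iff)
qed

text \<open>The order continuity needed for kernels. Dominated convergence with majorant
  \<open>\<bar>rep f x\<bar> powr p\<close> sends the integrals of the p-th powers of
  \<open>f - a n\<close> to 0, while \<open>S (f - a n) = S f\<close> for every \<open>n\<close>. So
  the previous lemma applies with \<open>h = S f\<close>.\<close>

lemma positive_operator_eq_zero_limit:
  assumes p: "1 \<le> p" and S: "positive_operator (Lp p) (Lp p) S"
    and f: "f \<in> Lp p" and a: "\<And>n. 0 \<le> a n" "\<And>n. a n \<le> f" "\<And>n. a n \<in> Lp p" "\<And>n. S (a n) = 0"
    and lim: "AE x in unit_interval_measure. (\<lambda>n. rep (a n) x) \<longlonglongrightarrow> rep f x"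
  shows "S f = 0"
proof -
  let ?\<mu> = unit_interval_measure
  have sub: "subspace (Lp p)" using p by (simp add: subspace_Lp)
  have "0 \<le> f" using a(1,2) order_trans by blast
  have "AE x in ?\<mu>. \<forall>n. rep (f - a n) x = rep f x - rep (a n) x"
    unfolding AE_all_countable using rep_minus by blast
  moreover have "AE x in ?\<mu>. \<forall>n. rep (a n) x \<le> rep f x"
    unfolding AE_all_countable using a(2) by (simp add: L0_le_iff)
  moreover have "AE x in ?\<mu>. \<forall>n. 0 \<le> rep (a n) x"
    unfolding AE_all_countable using a(1) by (simp add: nonneg_L0_iff)
  ultimately have ae: "AE x in ?\<mu>. \<forall>n. rep (f - a n) x = rep f x - rep (a n) x \<and>
      rep (a n) x \<le> rep f x \<and> 0 \<le> rep (a n) x"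
    by eventually_elim simp
  have "(\<lambda>n. \<integral>x. \<bar>rep (f - a n) x\<bar> powr p \<partial>?\<mu>) \<longlonglongrightarrow> (\<integral>x. 0 \<partial>?\<mu>)"
  proof (rule integral_dominated_convergence)
    show "integrable ?\<mu> (\<lambda>x. \<bar>rep f x\<bar> powr p)" using f by (simp add: Lp_iff)
    show "AE x in ?\<mu>. (\<lambda>n. \<bar>rep (f - a n) x\<bar> powr p) \<longlonglongrightarrow> 0"
      using ae lim
    proof eventually_elim
      case (elim x)
      have "(\<lambda>n. \<bar>rep f x - rep (a n) x\<bar>) \<longlonglongrightarrow> \<bar>rep f x - rep f x\<bar>"
        by (intro tendsto_intros elim)
      then have "(\<lambda>n. \<bar>rep (f - a n) x\<bar>) \<longlonglongrightarrow> 0" using elim(1) by simp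
      then show ?case
        using p by (intro tendsto_zero_powrI[where b = p]) auto
    qed
    show "AE x in ?\<mu>. norm (\<bar>rep (f - a n) x\<bar> powr p) \<le> \<bar>rep f x\<bar> powr p" for n
      using ae
    proof eventually_elim
      case (elim x)
      then have "\<bar>rep (f - a n) x\<bar> \<le> \<bar>rep f x\<bar>" using elim[rule_format, of n] by linarith
      then show ?case using p by (simp add: powr_mono2)
    qed
  qed measurable
  moreover have "S f \<le> S (f - a n)" for n
    using positive_operator_diff[OF S sub f a(3)] a(4) by simp
  ultimately have "S f \<le> 0"
    using a(2) Lp_minus[OF f a(3)] p
    by (intro positive_operator_null_sequence[OF p S, of "\<lambda>n. f - a n"]) auto
  moreover have "0 \<le> S f"
    using positive_operatorD(4)[OF S f \<open>0 \<le> f\<close>] .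
  ultimately show ?thesis by simp
qed

section \<open>Indicator functions and the exhaustion argument\<close>

definition chi :: "real set \<Rightarrow> L0" where
  "chi A = L0_of (indicator A)"

lemma rep_chi: "A \<in> sets borel \<Longrightarrow> AE x in unit_interval_measure. rep (chi A) x = indicator A x"
  unfolding chi_def by (intro rep_L0_of borel_measurable_unit_interval borel_measurable_indicator)

lemma chi_in_Lp:
  assumes "A \<in> sets borel"
  shows "chi A \<in> Lp p"
proof -
  have m[measurable]: "(indicator A :: real \<Rightarrow> real) \<in> borel_measurable unit_interval_measure"
    using assms by (intro borel_measurable_unit_interval borel_measurable_indicator)
  have "integrable unit_interval_measure (\<lambda>x. 1 :: real)"
    by (subst integrable_restrict_space) (auto simp: integrable_completion)
  then have "integrable unit_interval_measure (\<lambda>x. \<bar>indicator A x :: real\<bar> powr p)"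
  proof (rule Bochner_Integration.integrable_bound)
    show "(\<lambda>x. \<bar>indicator A x :: real\<bar> powr p) \<in> borel_measurable unit_interval_measure"
      by measurable
  qed (auto simp: indicator_def)
  then show ?thesis
    unfolding chi_def by (subst L0_of_in_Lp_iff[OF m])
qed

lemma chi_nonneg:
  assumes "A \<in> sets borel"
  shows "0 \<le> chi A"
  unfolding nonneg_L0_iff using rep_chi[OF assms] by eventually_elim auto

text \<open>A Borel probability measure on the whole line with the same almost everywhere statements
  as \<open>unit_interval_measure\<close>. It allows sets and functions to be handled without
  restricted spaces or completions.\<close>

definition unit_lborel :: "real measure" where
  "unit_lborel = density lborel (indicator {0..1})"

lemma sets_unit_lborel[measurable_cong, simp]: "sets unit_lborel = sets borel"
  and space_unit_lborel[simp]: "space unit_lborel = UNIV"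
  by (simp_all add: unit_lborel_def)

lemma AE_unit_lborel: "(AE x in unit_lborel. P x) \<longleftrightarrow> (AE x in unit_interval_measure. P x)"
  unfolding AE_unit_interval_iff unit_lborel_def
  by (subst AE_density) (auto simp: indicator_def intro!: eventually_cong)

interpretation unit_lborel: prob_space unit_lborel
  by (rule prob_spaceI) (simp add: unit_lborel_def emeasure_density)

text \<open>Exhaustion: the kernel consists of the functions living on a largest set whose
  indicator function is annihilated.\<close>

lemma positive_operator_abs_kernel:
  assumes p: "1 \<le> p" and S: "positive_operator (Lp p) (Lp p) S"
  obtains A where "A \<in> sets borel" "{f \<in> Lp p. S \<bar>f\<bar> = 0} = Lp_on p A"
proof -
  let ?\<mu> = unit_interval_measure
  have sub: "subspace (Lp p)" using p by (simp add: subspace_Lp)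
  have zeroI: "S f = 0" if "f \<in> Lp p" "0 \<le> f" "f \<le> g" "g \<in> Lp p" "S g = 0" for f g
    using positive_operator_mono[OF S sub that(1,4,3)] positive_operatorD(4)[OF S that(1,2)] that(5)
    by simp
  define F where "F = {A \<in> sets borel. S (chi A) = 0}"
  have F_union: "A \<union> B \<in> F" if "A \<in> F" "B \<in> F" for A B
  proof -
    have AB: "A \<in> sets borel" "B \<in> sets borel" "A \<union> B \<in> sets borel" using that by (auto simp: F_def)
    have "AE x in ?\<mu>. rep (chi (A \<union> B)) x \<le> rep (chi A + chi B) x"
      using rep_chi[OF AB(1)] rep_chi[OF AB(2)] rep_chi[OF AB(3)] rep_plus[of "chi A" "chi B"]
      by eventually_elim (auto simp: indicator_def)
    then have "chi (A \<union> B) \<le> chi A + chi B" by (simp add: L0_le_iff)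
    moreover have "S (chi A + chi B) = 0"
      using positive_operatorD(2)[OF S chi_in_Lp[OF AB(1)] chi_in_Lp[OF AB(2)]] that
      by (simp add: F_def)
    moreover have "chi A + chi B \<in> Lp p"
      using chi_in_Lp[OF AB(1)] chi_in_Lp[OF AB(2)] p by (simp add: Lp_plus)
    ultimately have "S (chi (A \<union> B)) = 0"
      using zeroI[OF chi_in_Lp[OF AB(3)] chi_nonneg[OF AB(3)]] by blast
    then show ?thesis using AB by (simp add: F_def)
  qed
  have "chi {} = 0"
    unfolding zero_L0_iff using rep_chi[of "{}"] by simp
  then have "{} \<in> F"
    using positive_operator_zero[OF S sub] by (simp add: F_def)
  \<comment> \<open>The measures are bounded by 1, so the supremum is finite. A union of sets
    approximating it attains it, which makes \<open>K\<close> maximal up to null sets.\<close>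
  define m where "m = (SUP A\<in>F. measure unit_lborel A)"
  have bdd: "bdd_above (measure unit_lborel ` F)"
    by (intro bdd_aboveI[of _ 1]) auto
  have le_m: "measure unit_lborel A \<le> m" if "A \<in> F" for A
    unfolding m_def using bdd that by (rule cSUP_upper2) simp
  have "\<exists>A\<in>F. m - 1 / real (Suc n) < measure unit_lborel A" for n
    using less_cSUP_iff[OF _ bdd, of "m - 1 / real (Suc n)"] \<open>{} \<in> F\<close> unfolding m_def[symmetric]
    by auto
  then obtain A where A: "\<And>n. A n \<in> F" "\<And>n. m - 1 / real (Suc n) < measure unit_lborel (A n)"
    by metis
  have A_borel: "A n \<in> sets borel" for n using A(1) by (simp add: F_def)
  define K where "K = (\<Union>n. A n)"
  have K_borel[measurable]: "K \<in> sets borel" unfolding K_def using A_borel by auto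
  \<comment> \<open>The \<open>A n\<close> need not be nested, so their indicators need not converge
    to that of \<open>K\<close>; those of the finite unions do.\<close>
  have B: "(\<Union>i\<le>n. A i) \<in> F" for n
    by (induction n) (auto simp: atMost_Suc A intro: F_union)
  then have B_borel: "(\<Union>i\<le>n. A i) \<in> sets borel" for n by (simp add: F_def)
  have "S (chi K) = 0"
  proof (rule positive_operator_eq_zero_limit[OF p S, where a = "\<lambda>n. chi (\<Union>i\<le>n. A i)"])
    show "chi (\<Union>i\<le>n. A i) \<le> chi K" for n
      unfolding L0_le_iff using rep_chi[OF B_borel[of n]] rep_chi[OF K_borel]
      by eventually_elim (auto simp: K_def indicator_def)
    show "S (chi (\<Union>i\<le>n. A i)) = 0" for n using B by (simp add: F_def)
    have "AE x in ?\<mu>. \<forall>n. rep (chi (\<Union>i\<le>n. A i)) x = indicator (\<Union>i\<le>n. A i) x"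
      unfolding AE_all_countable using rep_chi[OF B_borel] by blast
    then show "AE x in ?\<mu>. (\<lambda>n. rep (chi (\<Union>i\<le>n. A i)) x) \<longlonglongrightarrow> rep (chi K) x"
      using rep_chi[OF K_borel]
      by eventually_elim (use LIMSEQ_Suc[OF LIMSEQ_indicator_UN[of A]] in \<open>simp add: K_def lessThan_Suc_atMost\<close>)
  qed (rule chi_in_Lp[OF K_borel] chi_nonneg[OF B_borel] chi_in_Lp[OF B_borel])+
  have K_max: "m \<le> measure unit_lborel K"
  proof (rule field_le_epsilon)
    fix e :: real assume "0 < e"
    then obtain n where "1 / real (Suc n) < e" using nat_approx_posE by blast
    moreover have "measure unit_lborel (A n) \<le> measure unit_lborel K"
      using K_borel by (intro unit_lborel.finite_measure_mono) (auto simp: K_def)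
    ultimately show "m \<le> measure unit_lborel K + e" using A(2)[of n] by linarith
  qed
  \<comment> \<open>An unbounded \<open>f\<close> lies below no multiple of \<open>chi K\<close>,
    but its truncations do. At almost every point they equal \<open>\<bar>f\<bar>\<close> from some
    index on.\<close>
  have "S \<bar>f\<bar> = 0" if "f \<in> Lp_on p K" for f
  proof (rule positive_operator_eq_zero_limit[OF p S, where a = "\<lambda>n. inf \<bar>f\<bar> (real n *\<^sub>R chi K)"])
    have f: "f \<in> Lp p" and f0: "AE x in ?\<mu>. x \<notin> K \<longrightarrow> rep f x = 0"
      using that by (auto simp: Lp_on_def)
    show "\<bar>f\<bar> \<in> Lp p" using Lp_abs f p by simp
    show nonneg: "0 \<le> inf \<bar>f\<bar> (real n *\<^sub>R chi K)" for n
      using chi_nonneg[OF K_borel] by (simp add: scaleR_nonneg_nonneg)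
    show "inf \<bar>f\<bar> (real n *\<^sub>R chi K) \<le> \<bar>f\<bar>" for n by simp
    show mem: "inf \<bar>f\<bar> (real n *\<^sub>R chi K) \<in> Lp p" for n
      by (rule Lp_solid[OF f]) (use p in simp, subst abs_of_nonneg[OF nonneg], rule inf_le1)
    show "S (inf \<bar>f\<bar> (real n *\<^sub>R chi K)) = 0" for n
      using positive_operatorD(3)[OF S chi_in_Lp[OF K_borel], of "real n"] \<open>S (chi K) = 0\<close> p
      by (intro zeroI[OF mem nonneg, of n "real n *\<^sub>R chi K"] Lp_scaleR chi_in_Lp) auto
    have "AE x in ?\<mu>. \<forall>n. rep (inf \<bar>f\<bar> (real n *\<^sub>R chi K)) x = min (rep \<bar>f\<bar> x) (rep (real n *\<^sub>R chi K) x)"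
      unfolding AE_all_countable using rep_inf by blast
    moreover have "AE x in ?\<mu>. \<forall>n. rep (real n *\<^sub>R chi K) x = real n * rep (chi K) x"
      unfolding AE_all_countable using rep_scaleR by blast
    ultimately show "AE x in ?\<mu>. (\<lambda>n. rep (inf \<bar>f\<bar> (real n *\<^sub>R chi K)) x) \<longlonglongrightarrow> rep \<bar>f\<bar> x"
      using rep_chi[OF K_borel] rep_abs[of f] f0
    proof eventually_elim
      case (elim x)
      obtain N where N: "\<bar>rep f x\<bar> \<le> real N" using real_arch_simple by blast
      have "rep (inf \<bar>f\<bar> (real n *\<^sub>R chi K)) x = rep \<bar>f\<bar> x" if "N \<le> n" for n
        using elim N that by (cases "x \<in> K") auto
      then show ?case
        by (intro tendsto_eventually eventually_sequentiallyI[of N]) auto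
    qed
  qed
  \<comment> \<open>Where \<open>n \<bar>f\<bar>\<close> exceeds 1 it dominates the indicator, so
    adding this set to \<open>K\<close> stays within \<open>F\<close>. By maximality it adds only a
    null set. Letting \<open>n\<close> grow exhausts the set where \<open>f\<close> is
    non-zero.\<close>
  moreover have "f \<in> Lp_on p K" if f: "f \<in> Lp p" "S \<bar>f\<bar> = 0" for f
  proof -
    define C where "C n = K \<union> {x. 1 < real n * \<bar>rep f x\<bar>}" for n
    have C_borel: "C n \<in> sets borel" for n
      unfolding C_def by (intro sets.Un K_borel) measurable
    have "C n \<in> F" for n
    proof -
      have "AE x in ?\<mu>. rep (chi (C n)) x \<le> rep (chi K + real n *\<^sub>R \<bar>f\<bar>) x"
        using rep_chi[OF C_borel[of n]] rep_chi[OF K_borel] rep_abs[of f]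
          rep_plus[of "chi K" "real n *\<^sub>R \<bar>f\<bar>"] rep_scaleR[of "real n" "\<bar>f\<bar>"]
        by eventually_elim (auto simp: C_def indicator_def)
      then have "chi (C n) \<le> chi K + real n *\<^sub>R \<bar>f\<bar>" by (simp add: L0_le_iff)
      moreover have af: "\<bar>f\<bar> \<in> Lp p" "real n *\<^sub>R \<bar>f\<bar> \<in> Lp p"
        using Lp_abs[OF f(1)] Lp_scaleR p by auto
      moreover have "S (chi K + real n *\<^sub>R \<bar>f\<bar>) = 0"
        using positive_operatorD(2)[OF S chi_in_Lp[OF K_borel] af(2)]
          positive_operatorD(3)[OF S af(1)] f(2) \<open>S (chi K) = 0\<close> by simp
      moreover have "chi K + real n *\<^sub>R \<bar>f\<bar> \<in> Lp p"
        using chi_in_Lp[OF K_borel] af(2) p by (simp add: Lp_plus)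
      ultimately have "S (chi (C n)) = 0"
        using zeroI[OF chi_in_Lp[OF C_borel] chi_nonneg[OF C_borel]] by blast
      then show ?thesis using C_borel by (simp add: F_def)
    qed
    then have C_le: "measure unit_lborel (C n) \<le> measure unit_lborel K" for n
      using le_m K_max order_trans by blast
    have "measure unit_lborel (C n - K) = measure unit_lborel (C n) - measure unit_lborel K" for n
      using C_borel K_borel by (intro unit_lborel.finite_measure_Diff) (auto simp: C_def)
    then have "measure unit_lborel (C n - K) = 0" for n
      using C_le[of n] measure_nonneg[of unit_lborel "C n - K"] by (metis diff_ge_0_iff_ge eq_iff_diff_eq_0 order_antisym)
    then have "C n - K \<in> null_sets unit_lborel" for n
      using C_borel K_borel by (intro null_setsI) (auto simp: unit_lborel.emeasure_eq_measure)
    then have "AE x in ?\<mu>. x \<notin> C n - K" for n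
      using AE_not_in AE_unit_lborel by blast
    then have "AE x in ?\<mu>. \<forall>n. x \<notin> C n - K"
      unfolding AE_all_countable by blast
    then have "AE x in ?\<mu>. x \<notin> K \<longrightarrow> rep f x = 0"
    proof eventually_elim
      case (elim x)
      then have *: "x \<notin> K \<Longrightarrow> \<not> 1 < real n * \<bar>rep f x\<bar>" for n by (auto simp: C_def)
      show ?case
        using * reals_Archimedean3[of "\<bar>rep f x\<bar>"] by (metis zero_less_abs_iff)
    qed
    with f show ?thesis by (simp add: Lp_on_def)
  qed
  ultimately have "{f \<in> Lp p. S \<bar>f\<bar> = 0} = Lp_on p K"
    by (auto simp: Lp_on_def)
  with K_borel show thesis by (rule that)
qed

subsection \<open>Triangular form\<close>

text \<open>Statement (iv) as a predicate. The single equation encodes the whole matrix: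
  \<open>T13\<close> takes values in \<open>B1\<close>, and the components in \<open>B1\<close> and
  \<open>B2\<close> do not contribute.\<close>

definition corner_operator :: "real \<Rightarrow> (L0 \<Rightarrow> L0) \<Rightarrow> bool" where
  "corner_operator p T \<longleftrightarrow>
     (\<exists>B1 B2 B3 T13. nontrivial_band_decomposition3 (Lp p) B1 B2 B3 \<and>
        positive_operator B3 B1 T13 \<and>
        (\<forall>f1\<in>B1. \<forall>f2\<in>B2. \<forall>f3\<in>B3. T (f1 + f2 + f3) = T13 f3))"

text \<open>The restriction of \<open>T\<close> itself serves as the entry
  \<open>T13\<close>.\<close>

lemma corner_operatorI:
  assumes p: "0 \<le> p" and T: "positive_operator (Lp p) (Lp p) T"
    and A: "A \<in> sets borel" "B \<in> sets borel" "C \<in> sets borel"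
    and disj: "A \<inter> B = {}" "A \<inter> C = {}" "B \<inter> C = {}" and un: "A \<union> B \<union> C = UNIV"
    and nontriv: "Lp_on p A \<noteq> {0}" "Lp_on p B \<noteq> {0}" "Lp_on p C \<noteq> {0}"
    and range: "\<And>f. f \<in> Lp_on p C \<Longrightarrow> T f \<in> Lp_on p A"
    and null: "\<And>f. f \<in> Lp_on p A \<union> Lp_on p B \<Longrightarrow> T f = 0"
  shows "corner_operator p T"
  unfolding corner_operator_def
proof (intro exI conjI ballI)
  show "nontrivial_band_decomposition3 (Lp p) (Lp_on p A) (Lp_on p B) (Lp_on p C)"
    unfolding nontrivial_band_decomposition3_def
    using band_decomposition3_Lp_on[OF p A disj un] nontriv by blast
  show "positive_operator (Lp_on p C) (Lp_on p A) T"
    by (rule positive_operator_subset[OF T _ range]) (simp_all add: Lp_on_def)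
  fix f1 f2 f3 assume f: "f1 \<in> Lp_on p A" "f2 \<in> Lp_on p B" "f3 \<in> Lp_on p C"
  then have mem: "f1 \<in> Lp p" "f2 \<in> Lp p" "f3 \<in> Lp p" by (auto simp: Lp_on_def)
  have "T (f1 + f2 + f3) = T f1 + T f2 + T f3"
    using positive_operatorD(2)[OF T Lp_plus[OF mem(1,2) p] mem(3)] positive_operatorD(2)[OF T mem(1,2)]
    by simp
  then show "T (f1 + f2 + f3) = T f3"
    using null f by simp
qed

lemma Lp_on_nontrivial:
  assumes "E \<in> sets borel" "emeasure unit_lborel E \<noteq> 0"
  shows "Lp_on p E \<noteq> {0}"
proof
  assume *: "Lp_on p E = {0}"
  have "chi E \<in> Lp_on p E"
    using chi_in_Lp[OF assms(1)] rep_chi[OF assms(1)] by (auto simp: Lp_on_def)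
  then have "AE x in unit_interval_measure. rep (chi E) x = 0"
    using * zero_L0_iff by auto
  then have "AE x in unit_interval_measure. x \<notin> E"
    using rep_chi[OF assms(1)] by eventually_elim (simp add: indicator_def split: if_splits)
  then have "AE x in unit_lborel. x \<notin> E"
    by (simp add: AE_unit_lborel)
  then have "emeasure unit_lborel E = 0"
    using assms(1) by (subst (asm) AE_iff_measurable[OF _ refl]) auto
  with assms(2) show False by simp
qed

text \<open>Any three non-zero bands would do; the interval is cut into thirds. The outer sets are
  unbounded so that the three partition the line.\<close>

lemma corner_operator_zero:
  assumes p: "0 \<le> p" and T: "positive_operator (Lp p) (Lp p) T"
    and zero_nonneg: "\<And>f. f \<in> Lp p \<Longrightarrow> 0 \<le> f \<Longrightarrow> T f = 0"
  shows "corner_operator p T"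
proof (rule corner_operatorI[OF p T])
  have zero: "T f = 0" if "f \<in> Lp p" for f
    by (rule positive_operator_eq_zero_of_nonneg[OF T subspace_Lp[OF p] Lp_abs[OF _ p] zero_nonneg that])
  let ?A = "{..<1/3} :: real set" and ?B = "{1/3..<2/3} :: real set" and ?C = "{2/3..} :: real set"
  show "?A \<in> sets borel" "?B \<in> sets borel" "?C \<in> sets borel" by auto
  show "?A \<inter> ?B = {}" "?A \<inter> ?C = {}" "?B \<inter> ?C = {}" "?A \<union> ?B \<union> ?C = UNIV" by auto
  have "emeasure unit_lborel X = emeasure lborel ({0..1} \<inter> X)" if "X \<in> sets borel" for X
    using that unfolding unit_lborel_def
    by (subst emeasure_density) (auto simp: indicator_inter_arith[symmetric])
  moreover have "{0..1} \<inter> ?A = {0..<1/3}" "{0..1} \<inter> ?B = {1/3..<2/3}" "{0..1} \<inter> ?C = {2/3..1}" by auto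
  ultimately have "emeasure unit_lborel ?A \<noteq> 0" "emeasure unit_lborel ?B \<noteq> 0"
    "emeasure unit_lborel ?C \<noteq> 0"
    by simp_all
  then show "Lp_on p ?A \<noteq> {0}" "Lp_on p ?B \<noteq> {0}" "Lp_on p ?C \<noteq> {0}"
    by (simp_all add: Lp_on_nontrivial)
  show "T f \<in> Lp_on p ?A" if "f \<in> Lp_on p ?C" for f
    using that zero[of f] ideal_in_Lp_on[OF p, of ?A] by (auto simp: Lp_on_def ideal_in_def subspace_def)
  show "T f = 0" if "f \<in> Lp_on p ?A \<union> Lp_on p ?B" for f
    using that zero by (auto simp: Lp_on_def)
qed

text \<open>With \<open>N\<close> denoting absolute kernels, the bands are \<open>N(T) \<inter> N(S)\<close>, the complement
  of \<open>N(S)\<close> in \<open>N(T)\<close>, and the complement of \<open>N(T)\<close>.\<close>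

lemma corner_operator_criterion:
  assumes p: "1 \<le> p" and T: "positive_operator (Lp p) (Lp p) T" and S: "positive_operator (Lp p) (Lp p) S"
    and TT: "\<And>f. f \<in> Lp p \<Longrightarrow> T (T f) = 0" and ST: "\<And>f. f \<in> Lp p \<Longrightarrow> S (T f) = 0"
    and f: "f \<in> Lp p" "T f \<noteq> 0" and g: "g \<in> Lp p" "0 \<le> g" "T g = 0" "S g \<noteq> 0"
  shows "corner_operator p T"
proof -
  have p0: "0 \<le> p" using p by simp
  have sub: "subspace (Lp p)" using p0 by (rule subspace_Lp)
  obtain A where A: "A \<in> sets borel" "{f \<in> Lp p. T \<bar>f\<bar> = 0} = Lp_on p A"
    using positive_operator_abs_kernel[OF p T] .
  obtain C where C: "C \<in> sets borel" "{f \<in> Lp p. S \<bar>f\<bar> = 0} = Lp_on p C"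
    using positive_operator_abs_kernel[OF p S] .
  have T_null: "T h = 0" if "h \<in> Lp_on p A" for h
    using positive_operator_eq_zero_of_abs[OF T sub _ Lp_abs[OF _ p0]] that A(2) by blast
  \<comment> \<open>Membership in absolute kernels concerns \<open>\<bar>T h\<bar>\<close>, not
    \<open>T h\<close>. The estimate \<open>\<bar>T h\<bar> \<le> T \<bar>h\<bar>\<close> reduces it
    to the hypotheses on \<open>T T\<close> and \<open>S T\<close>.\<close>
  have range: "T h \<in> Lp_on p (A \<inter> C)" if h: "h \<in> Lp p" for h
  proof -
    have ah: "\<bar>h\<bar> \<in> Lp p" and Th: "T h \<in> Lp p" and Tah: "T \<bar>h\<bar> \<in> Lp p"
      using Lp_abs[OF h p0] positive_operatorD(1)[OF T] h by auto
    have le: "\<bar>T h\<bar> \<le> T \<bar>h\<bar>"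
      using positive_operator_abs_le[OF T sub h ah] .
    have "T \<bar>T h\<bar> \<le> 0" "S \<bar>T h\<bar> \<le> 0"
      using positive_operator_mono[OF T sub Lp_abs[OF Th p0] Tah le] TT[OF ah]
        positive_operator_mono[OF S sub Lp_abs[OF Th p0] Tah le] ST[OF ah] by simp_all
    moreover have "0 \<le> T \<bar>T h\<bar>" "0 \<le> S \<bar>T h\<bar>"
      using positive_operatorD(4)[OF T Lp_abs[OF Th p0]] positive_operatorD(4)[OF S Lp_abs[OF Th p0]]
      by simp_all
    ultimately have "T h \<in> Lp_on p A" "T h \<in> Lp_on p C"
      using A(2) C(2) Th by auto
    then show ?thesis
      unfolding Lp_on_def by auto
  qed
  show ?thesis
  proof (rule corner_operatorI[OF p0 T, where A = "A \<inter> C" and B = "A - C" and C = "- A"])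
    show "A \<inter> C \<in> sets borel" "A - C \<in> sets borel" "- A \<in> sets borel"
      using A(1) C(1) by auto
    show "Lp_on p (A \<inter> C) \<noteq> {0}"
      using range[OF f(1)] f(2) by auto
    show "Lp_on p (- A) \<noteq> {0}"
    proof
      assume "Lp_on p (- A) = {0}"
      then have "cut (- A) f = 0"
        using cut_in_Lp_on[OF f(1) p0, of "- A"] A(1) by auto
      then have "AE x in unit_interval_measure. x \<notin> A \<longrightarrow> rep f x = 0"
        using rep_cut[of "- A" f] A(1) unfolding zero_L0_iff
        by (auto elim: eventually_elim2)
      then have "f \<in> Lp_on p A" using f(1) by (simp add: Lp_on_def)
      with T_null f(2) show False by blast
    qed
    \<comment> \<open>The witness is the part of \<open>g\<close> off \<open>C\<close>. It lives on
      \<open>A\<close> because \<open>T g = 0\<close>, and if it vanished then \<open>g\<close>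
      would lie in the absolute kernel of \<open>S\<close>.\<close>
    show "Lp_on p (A - C) \<noteq> {0}"
    proof
      assume *: "Lp_on p (A - C) = {0}"
      have gA: "g \<in> Lp_on p A"
        unfolding A(2)[symmetric] using g(1-3) by (simp add: abs_of_nonneg)
      have "cut (- C) g \<in> Lp_on p (- C)" "AE x in unit_interval_measure. rep (cut (- C) g) x = indicator (- C) x * rep g x"
        using cut_in_Lp_on[OF g(1) p0, of "- C"] rep_cut[of "- C" g] C(1) by auto
      note cut = this
      have "AE x in unit_interval_measure. x \<notin> A \<longrightarrow> rep g x = 0"
        using gA by (simp add: Lp_on_def)
      then have "AE x in unit_interval_measure. x \<notin> A - C \<longrightarrow> rep (cut (- C) g) x = 0"
        using cut(2) by eventually_elim auto
      then have "cut (- C) g \<in> Lp_on p (A - C)"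
        using cut(1) by (simp add: Lp_on_def)
      then have "AE x in unit_interval_measure. rep (cut (- C) g) x = 0"
        using * zero_L0_iff by auto
      then have "AE x in unit_interval_measure. x \<notin> C \<longrightarrow> rep g x = 0"
        using cut(2) by eventually_elim auto
      then have "g \<in> Lp_on p C" using g(1) by (simp add: Lp_on_def)
      then have "S g = 0"
        unfolding C(2)[symmetric] using g(2) by (simp add: abs_of_nonneg)
      with g(4) show False ..
    qed
    show "T h \<in> Lp_on p (A \<inter> C)" if "h \<in> Lp_on p (- A)" for h
      using that range by (auto simp: Lp_on_def)
    have "Lp_on p (A \<inter> C) \<subseteq> Lp_on p A" "Lp_on p (A - C) \<subseteq> Lp_on p A"
      by (auto simp: Lp_on_def elim: eventually_mono)
    then show "T h = 0" if "h \<in> Lp_on p (A \<inter> C) \<union> Lp_on p (A - C)" for h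
      using that T_null by blast
  qed auto
qed

text \<open>The function separating the kernels is \<open>U f\<close>: applying \<open>T\<close>
  gives the third power of \<open>U\<close>, which is zero, whereas applying \<open>U\<close> gives
  \<open>T f\<close>.\<close>

lemma corner_operator_of_square:
  assumes p: "1 \<le> p" and T: "positive_operator (Lp p) (Lp p) T" and U: "positive_operator (Lp p) (Lp p) U"
    and TU: "\<And>f. f \<in> Lp p \<Longrightarrow> T f = U (U f)" and U3: "\<And>f. f \<in> Lp p \<Longrightarrow> U (U (U f)) = 0"
  shows "corner_operator p T"
proof (cases "\<forall>f\<in>Lp p. 0 \<le> f \<longrightarrow> T f = 0")
  case True
  then show ?thesis using p by (intro corner_operator_zero[OF _ T]) simp_all
next
  case False
  then obtain f where f: "f \<in> Lp p" "0 \<le> f" "T f \<noteq> 0" by blast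
  have mem: "U h \<in> Lp p" if "h \<in> Lp p" for h using positive_operatorD(1)[OF U that] .
  have "U 0 = 0" using positive_operator_zero[OF U subspace_Lp] p by simp
  show ?thesis
  proof (rule corner_operator_criterion[OF p T U _ _ f(1,3)])
    show "T (T h) = 0" "U (T h) = 0" if "h \<in> Lp p" for h
      using that mem TU U3 \<open>U 0 = 0\<close> by simp_all
    show "U f \<in> Lp p" "0 \<le> U f" "T (U f) = 0" "U (U f) \<noteq> 0"
      using f mem TU U3 positive_operatorD(4)[OF U] by auto
  qed
qed

text \<open>The function separating the kernels is \<open>N f\<close>. Indeed \<open>T (N f)\<close>
  consists of the terms \<open>M (N (N f))\<close> and \<open>N (M (N f))\<close>, both zero, while
  \<open>M + N\<close> sends \<open>N f\<close> to \<open>M (N f)\<close>.\<close>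

lemma corner_operator_of_commutator:
  assumes p: "1 \<le> p" and T: "positive_operator (Lp p) (Lp p) T"
    and M: "positive_operator (Lp p) (Lp p) M" and N: "positive_operator (Lp p) (Lp p) N"
    and T_eq: "\<And>f. f \<in> Lp p \<Longrightarrow> T f = M (N f) - N (M f)"
    and MM: "\<And>f. f \<in> Lp p \<Longrightarrow> M (M f) = 0" and NN: "\<And>f. f \<in> Lp p \<Longrightarrow> N (N f) = 0"
  shows "corner_operator p T"
proof (cases "\<forall>f\<in>Lp p. 0 \<le> f \<longrightarrow> T f = 0")
  case True
  then show ?thesis using p by (intro corner_operator_zero[OF _ T]) simp_all
next
  case False
  then obtain f where f: "f \<in> Lp p" "0 \<le> f" "T f \<noteq> 0" by blast
  have sub: "subspace (Lp p)" using p by (simp add: subspace_Lp)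
  have mem: "M h \<in> Lp p" "N h \<in> Lp p" "T h \<in> Lp p" if "h \<in> Lp p" for h
    using positive_operatorD(1) M N T that by blast+
  have zero: "M 0 = 0" "N 0 = 0"
    using positive_operator_zero[OF M sub] positive_operator_zero[OF N sub] by simp_all
  have nonneg: "0 \<le> M h" "0 \<le> N h" "0 \<le> T h" if "h \<in> Lp p" "0 \<le> h" for h
    using positive_operatorD(4) M N T that by blast+
  have NM_le: "N (M h) \<le> M (N h)" if "h \<in> Lp p" "0 \<le> h" for h
    using nonneg(3)[OF that] T_eq[OF that(1)] by simp
  have MNM: "M (N (M h)) = 0" if h: "h \<in> Lp p" for h
  proof (rule positive_operator_eq_zero_of_nonneg[OF positive_operator_compose[OF M positive_operator_compose[OF N M]] sub _ _ h])
    fix k assume k: "k \<in> Lp p" "0 \<le> k"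
    have "M (N (M k)) \<le> M (M (N k))"
      using mem k NM_le by (intro positive_operator_mono[OF M sub]) auto
    then have "M (N (M k)) \<le> 0" using MM mem k by simp
    then show "M (N (M k)) = 0" using mem nonneg k by (intro antisym) auto
  qed (use p in \<open>simp add: Lp_abs\<close>)
  have NMN: "N (M (N h)) = 0" if h: "h \<in> Lp p" for h
  proof (rule positive_operator_eq_zero_of_nonneg[OF positive_operator_compose[OF N positive_operator_compose[OF M N]] sub _ _ h])
    fix k assume k: "k \<in> Lp p" "0 \<le> k"
    have "N (M (N k)) \<le> M (N (N k))"
      using mem nonneg k by (intro NM_le) auto
    then have "N (M (N k)) \<le> 0" using NN mem k zero by simp
    then show "N (M (N k)) = 0" using mem nonneg k by (intro antisym) auto
  qed (use p in \<open>simp add: Lp_abs\<close>)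
  have MT: "M (T h) = 0" and NT: "N (T h) = 0" if "h \<in> Lp p" for h
    using that T_eq positive_operator_diff[OF M sub] positive_operator_diff[OF N sub] mem MM NN MNM NMN
    by simp_all
  show ?thesis
  proof (rule corner_operator_criterion[OF p T positive_operator_add[OF M N sub] _ _ f(1,3)])
    show "T (T h) = 0" "M (T h) + N (T h) = 0" if "h \<in> Lp p" for h
      using T_eq[OF mem(3)[OF that]] MT NT zero that by simp_all
    show "N f \<in> Lp p" "0 \<le> N f" using mem nonneg f by auto
    show "T (N f) = 0" using T_eq mem NN NMN zero f by simp
    show "M (N f) + N (N f) \<noteq> 0"
    proof
      assume "M (N f) + N (N f) = 0"
      \<comment> \<open>Without the term \<open>M (N f)\<close> the operator would give
        \<open>T f \<le> 0\<close>, so positivity would force \<open>T f = 0\<close>.\<close>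
      then have "T f = - N (M f)" using NN T_eq f by simp
      moreover have "0 \<le> N (M f)" "0 \<le> T f" using mem nonneg f by auto
      ultimately show False using f(3) by (metis antisym neg_le_0_iff_le)
    qed
  qed
qed

subsection \<open>Factorization through a band\<close>

lemma integrable_unit_interval_iff:
  fixes h :: "real \<Rightarrow> real"
  assumes [measurable]: "h \<in> borel_measurable borel"
  shows "integrable unit_interval_measure h \<longleftrightarrow> integrable unit_lborel h"
proof -
  have "integrable unit_interval_measure h \<longleftrightarrow> integrable lborel (\<lambda>x. indicator {0..1} x *\<^sub>R h x)"
    by (subst integrable_restrict_space) (simp_all add: integrable_completion)
  also have "\<dots> \<longleftrightarrow> integrable unit_lborel h"
    unfolding unit_lborel_def ennreal_indicator[symmetric]
    by (subst integrable_density) (auto simp: mult.commute)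
  finally show ?thesis .
qed

text \<open>In this form, membership can be checked by the change of variables inequality for
  non-negative integrals.\<close>

lemma Lp_iff_nn_integral:
  "f \<in> Lp p \<longleftrightarrow> (\<integral>\<^sup>+x. ennreal (\<bar>rep f x\<bar> powr p) \<partial>unit_lborel) < \<infinity>"
  unfolding Lp_iff by (subst integrable_unit_interval_iff) (auto simp: integrable_iff_bounded)

text \<open>The inequality says that \<open>\<phi>\<close> pushes the measure on \<open>W\<close> to
  at most \<open>c\<close> times \<open>unit_lborel\<close>. This one condition makes composition
  with \<open>\<phi>\<close> well defined on classes and keeps it inside
  \<open>Lp p\<close>.\<close>

locale composition_operator =
  fixes W :: "real set" and \<phi> :: "real \<Rightarrow> real" and c :: ennreal
  assumes W[measurable]: "W \<in> sets borel" and \<phi>[measurable]: "\<phi> \<in> borel_measurable borel"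
    and c: "c < \<infinity>"
    and le: "\<And>h. h \<in> borel_measurable borel \<Longrightarrow>
      (\<integral>\<^sup>+x. h (\<phi> x) * indicator W x \<partial>unit_lborel) \<le> c * (\<integral>\<^sup>+x. h x \<partial>unit_lborel)"
begin

definition compose_op :: "L0 \<Rightarrow> L0" where
  "compose_op f = L0_of (\<lambda>x. indicator W x * rep f (\<phi> x))"

lemma rep_comp: "AE x in unit_interval_measure. rep (compose_op f) x = indicator W x * rep f (\<phi> x)"
  unfolding compose_op_def by (intro rep_L0_of borel_measurable_unit_interval) measurable

text \<open>Apply \<open>le\<close> to the indicator of the exceptional set: its preimage within
  \<open>W\<close> is again null.\<close>

lemma AE_comp:
  assumes "AE y in unit_interval_measure. P y" and [measurable]: "Measurable.pred borel P"
  shows "AE x in unit_interval_measure. x \<in> W \<longrightarrow> P (\<phi> x)"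
proof -
  have "AE y in unit_lborel. P y"
    using assms(1) by (simp add: AE_unit_lborel)
  then have "(\<integral>\<^sup>+y. indicator {y. \<not> P y} y \<partial>unit_lborel) = 0"
    by (subst nn_integral_0_iff_AE) (auto elim!: eventually_mono)
  then have "(\<integral>\<^sup>+x. indicator {y. \<not> P y} (\<phi> x) * indicator W x \<partial>unit_lborel) = 0"
    using le[of "indicator {y. \<not> P y}"] by simp
  then have "AE x in unit_lborel. indicator {y. \<not> P y} (\<phi> x) * indicator W x = (0 :: ennreal)"
    by (subst (asm) nn_integral_0_iff_AE) auto
  then have "AE x in unit_lborel. x \<in> W \<longrightarrow> P (\<phi> x)"
    by eventually_elim (auto simp: indicator_def split: if_splits)
  then show ?thesis by (simp add: AE_unit_lborel)
qed

lemma comp_in_Lp_on: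
  assumes p: "0 \<le> p" and f: "f \<in> Lp p"
  shows "compose_op f \<in> Lp_on p W"
proof -
  have "AE x in unit_lborel. rep (compose_op f) x = indicator W x * rep f (\<phi> x)"
    using rep_comp by (simp add: AE_unit_lborel)
  then have "(\<integral>\<^sup>+x. ennreal (\<bar>rep (compose_op f) x\<bar> powr p) \<partial>unit_lborel)
      \<le> (\<integral>\<^sup>+x. ennreal (\<bar>rep f (\<phi> x)\<bar> powr p) * indicator W x \<partial>unit_lborel)"
    by (intro nn_integral_mono_AE) (auto simp: indicator_def elim!: eventually_mono)
  also have "\<dots> \<le> c * (\<integral>\<^sup>+x. ennreal (\<bar>rep f x\<bar> powr p) \<partial>unit_lborel)"
    by (rule le) measurable
  also have "\<dots> < \<infinity>"
    using f c by (simp add: Lp_iff_nn_integral ennreal_mult_less_top)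
  finally have "compose_op f \<in> Lp p" by (simp add: Lp_iff_nn_integral)
  moreover have "AE x in unit_interval_measure. x \<notin> W \<longrightarrow> rep (compose_op f) x = 0"
    using rep_comp[of f] by eventually_elim simp
  ultimately show ?thesis by (simp add: Lp_on_def)
qed

lemma positive_operator_comp:
  assumes p: "0 \<le> p"
  shows "positive_operator (Lp p) (Lp p) compose_op"
  unfolding positive_operator_def
proof (intro conjI ballI allI impI)
  show "compose_op f \<in> Lp p" if "f \<in> Lp p" for f
    using comp_in_Lp_on[OF p that] by (simp add: Lp_on_def)
  show "compose_op (f + g) = compose_op f + compose_op g" for f g
  proof -
    have "AE x in unit_interval_measure. x \<in> W \<longrightarrow> rep (f + g) (\<phi> x) = rep f (\<phi> x) + rep g (\<phi> x)"
      by (rule AE_comp[OF rep_plus]) measurable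
    then show ?thesis
      unfolding L0_eq_iff
      using rep_comp[of f] rep_comp[of g] rep_comp[of "f + g"] rep_plus[of "compose_op f" "compose_op g"]
      by eventually_elim (auto simp: indicator_def)
  qed
  show "compose_op (r *\<^sub>R f) = r *\<^sub>R compose_op f" for r f
  proof -
    have "AE x in unit_interval_measure. x \<in> W \<longrightarrow> rep (r *\<^sub>R f) (\<phi> x) = r * rep f (\<phi> x)"
      by (rule AE_comp[OF rep_scaleR]) measurable
    then show ?thesis
      unfolding L0_eq_iff
      using rep_comp[of f] rep_comp[of "r *\<^sub>R f"] rep_scaleR[of r "compose_op f"]
      by eventually_elim (auto simp: indicator_def)
  qed
  show "0 \<le> compose_op f" if "0 \<le> f" for f
  proof -
    have "AE x in unit_interval_measure. x \<in> W \<longrightarrow> 0 \<le> rep f (\<phi> x)"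
      using that by (intro AE_comp) (simp_all add: nonneg_L0_iff)
    then show ?thesis
      unfolding nonneg_L0_iff using rep_comp[of f] by eventually_elim (auto simp: indicator_def)
  qed
qed

end

text \<open>Quantile functions live on the open interval with restricted Lebesgue measure; this
  passes between that space and \<open>unit_lborel\<close>.\<close>

lemma nn_integral_unit_lborel_interior:
  assumes [measurable]: "h \<in> borel_measurable borel"
  shows "(\<integral>\<^sup>+x. h x * indicator {0<..<1} x \<partial>unit_lborel)
    = (\<integral>\<^sup>+x. h x \<partial>restrict_space lborel {0<..<1::real})"
proof -
  have "(\<integral>\<^sup>+x. h x * indicator {0<..<1} x \<partial>unit_lborel)
      = (\<integral>\<^sup>+x. indicator {0..1} x * (h x * indicator {0<..<1} x) \<partial>lborel)"
    unfolding unit_lborel_def by (subst nn_integral_density) auto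
  also have "\<dots> = (\<integral>\<^sup>+x. h x * indicator {0<..<1} x \<partial>lborel)"
    by (intro nn_integral_cong) (auto simp: indicator_def)
  finally show ?thesis
    by (subst nn_integral_restrict_space) auto
qed

text \<open>The distribution function of the normalised measure on \<open>E\<close> and its quantile function are
  mutually inverse up to null sets and map these measures to each other; composing with them
  gives the embedding \<open>J\<close> and its left inverse \<open>P\<close>.\<close>

lemma ex_positive_embedding:
  assumes p: "0 \<le> p" and E[measurable]: "E \<in> sets borel" and pos: "emeasure unit_lborel E \<noteq> 0"
  obtains J P where "positive_operator (Lp p) (Lp p) J" "positive_operator (Lp p) (Lp p) P"
    "\<And>f. f \<in> Lp p \<Longrightarrow> J f \<in> Lp_on p E" "\<And>f. f \<in> Lp p \<Longrightarrow> P (J f) = f"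
proof -
  define c where "c = emeasure unit_lborel E"
  have c: "c \<noteq> 0" "c < \<infinity>" "c \<noteq> \<infinity>"
    using pos by (simp_all add: c_def unit_lborel.emeasure_eq_measure)
  define M where "M = uniform_measure unit_lborel E"
  have M_sets: "sets M = sets borel" by (simp add: M_def)
  interpret M: prob_space M
    unfolding M_def using c by (intro prob_space_uniform_measure) (simp_all add: c_def)
  interpret M: cdf_distribution M
    by unfold_locales (simp_all add: M_sets)
  let ?\<Omega> = "restrict_space lborel {0<..<1::real}"
  \<comment> \<open>The quantile function \<open>M.I\<close> is meaningful only for arguments
    strictly between 0 and 1. The default 0 elsewhere makes \<open>Q\<close> Borel on the whole
    line.\<close>
  define Q where "Q t = (if t \<in> {0<..<1} then M.I t else 0)" for t
  have "{t. t \<in> {0<..<1::real}} = {0<..<1}" by (rule Collect_mem_eq)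
  then have Q_meas[measurable]: "Q \<in> borel_measurable borel"
    unfolding Q_def
    by (intro measurable_If_restrict_space_iff[THEN iffD2]) (simp_all only: M.measurable_CI, simp_all)
  have nn_M: "(\<integral>\<^sup>+x. h x \<partial>M) = (\<integral>\<^sup>+x. h x * indicator E x \<partial>unit_lborel) / c"
    if [measurable]: "h \<in> borel_measurable borel" for h
    unfolding M_def c_def by (subst nn_integral_uniform_measure) auto
  have nn_Q: "(\<integral>\<^sup>+x. h x \<partial>M) = (\<integral>\<^sup>+t. h (Q t) \<partial>?\<Omega>)"
    if [measurable]: "h \<in> borel_measurable borel" for h
  proof -
    have "(\<integral>\<^sup>+x. h x \<partial>M) = (\<integral>\<^sup>+x. h x \<partial>distr ?\<Omega> borel M.I)"
      by (simp add: M.distr_I_eq_M)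
    also have "\<dots> = (\<integral>\<^sup>+t. h (M.I t) \<partial>?\<Omega>)"
      using M.measurable_CI by (intro nn_integral_distr) (simp_all cong: measurable_cong_sets sets_restrict_space_cong)
    also have "\<dots> = (\<integral>\<^sup>+t. h (Q t) \<partial>?\<Omega>)"
      by (intro nn_integral_cong) (simp add: Q_def space_restrict_space)
    finally show ?thesis .
  qed
  have atomless: "measure M {x} = 0" for x
  proof -
    have "emeasure unit_lborel {x} = 0"
      unfolding unit_lborel_def by (subst emeasure_density) (auto intro!: nn_integral_null_set[of "{x}" lborel, simplified])
    then have "emeasure unit_lborel (E \<inter> {x}) = 0"
      using emeasure_mono[of "E \<inter> {x}" "{x}" unit_lborel] by simp
    then show ?thesis
      unfolding M_def measure_def by simp
  qed
  \<comment> \<open>Just to the left of \<open>Q t\<close> the distribution function is at most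
    \<open>t\<close>. Since \<open>M\<close> has no atoms it is continuous, so this bound persists
    at \<open>Q t\<close>.\<close>
  have FQ: "cdf M (Q t) = t" if t: "t \<in> {0<..<1}" for t
  proof (rule antisym)
    have Q: "t \<le> cdf M x \<longleftrightarrow> Q t \<le> x" for x
      using M.pseudoinverse[of t x] t by (simp add: Q_def)
    show "t \<le> cdf M (Q t)" by (simp add: Q)
    have "((cdf M) \<longlongrightarrow> cdf M (Q t)) (at_left (Q t))"
      using M.isCont_cdf[of "Q t"] atomless by (auto simp: isCont_def intro: tendsto_within_subset)
    moreover have "eventually (\<lambda>x. cdf M x \<le> t) (at_left (Q t))"
      unfolding eventually_at_filter by (intro always_eventually) (metis Q lessThan_iff not_less le_cases)
    ultimately show "cdf M (Q t) \<le> t"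
      by (intro tendsto_upperbound) auto
  qed
  \<comment> \<open>Under \<open>M\<close> the function \<open>cdf M\<close> is uniformly
    distributed, by \<open>FQ\<close>. Undoing the normalisation of \<open>M\<close> yields the
    factor \<open>c\<close>.\<close>
  interpret J: composition_operator E "cdf M" c
  proof
    fix h :: "real \<Rightarrow> ennreal" assume [measurable]: "h \<in> borel_measurable borel"
    have "(\<integral>\<^sup>+x. h (cdf M x) * indicator E x \<partial>unit_lborel) = c * (\<integral>\<^sup>+x. h (cdf M x) \<partial>M)"
      using c by (subst nn_M) (simp_all add: ennreal_times_divide mult_divide_eq_ennreal mult.commute[of c])
    also have "(\<integral>\<^sup>+x. h (cdf M x) \<partial>M) = (\<integral>\<^sup>+t. h (cdf M (Q t)) \<partial>?\<Omega>)"
      by (rule nn_Q) measurable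
    also have "\<dots> = (\<integral>\<^sup>+t. h t \<partial>?\<Omega>)"
      by (intro nn_integral_cong) (simp add: FQ space_restrict_space)
    also have "\<dots> \<le> (\<integral>\<^sup>+t. h t \<partial>unit_lborel)"
      by (subst nn_integral_unit_lborel_interior[symmetric])
        (auto intro!: nn_integral_mono simp: indicator_def)
    finally show "(\<integral>\<^sup>+x. h (cdf M x) * indicator E x \<partial>unit_lborel) \<le> c * (\<integral>\<^sup>+x. h x \<partial>unit_lborel)"
      by (simp add: mult_left_mono)
  qed (use c in auto)
  have Q_integral: "(\<integral>\<^sup>+t. h (Q t) * indicator {0<..<1} t \<partial>unit_lborel)
      = (\<integral>\<^sup>+x. h x * indicator E x \<partial>unit_lborel) / c"
    if [measurable]: "h \<in> borel_measurable borel" for h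
    using nn_integral_unit_lborel_interior[of "\<lambda>t. h (Q t)"] nn_Q[OF that] nn_M[OF that] by simp
  \<comment> \<open>\<open>Q\<close> carries Lebesgue measure on the open interval to
    \<open>M\<close>, whose density is at most \<open>1 / c\<close>.\<close>
  interpret P: composition_operator "{0<..<1}" Q "1 / c"
  proof
    show "1 / c < \<infinity>" using c by (simp add: less_top[symmetric] ennreal_divide_eq_top_iff)
    fix h :: "real \<Rightarrow> ennreal" assume h: "h \<in> borel_measurable borel"
    have "(\<integral>\<^sup>+t. h (Q t) * indicator {0<..<1} t \<partial>unit_lborel) \<le> (\<integral>\<^sup>+x. h x \<partial>unit_lborel) / c"
      unfolding Q_integral[OF h]
      by (intro divide_right_mono_ennreal nn_integral_mono) (auto simp: indicator_def)
    then show "(\<integral>\<^sup>+t. h (Q t) * indicator {0<..<1} t \<partial>unit_lborel) \<le> 1 / c * (\<integral>\<^sup>+x. h x \<partial>unit_lborel)"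
      by (simp add: ennreal_times_divide mult.commute)
  qed auto
  have "(\<integral>\<^sup>+t. indicator (- E) (Q t) * indicator {0<..<1} t \<partial>unit_lborel) = 0"
    by (subst Q_integral) (auto simp: indicator_inter_arith[symmetric] simp del: indicator_inter_arith)
  then have "AE t in unit_lborel. indicator (- E) (Q t) * indicator {0<..<1} t = (0 :: ennreal)"
    by (subst (asm) nn_integral_0_iff_AE) auto
  \<comment> \<open>\<open>M\<close> gives no mass to the complement of \<open>E\<close>. Hence the
    cut-off by \<open>indicator E\<close> inside \<open>J\<close> is invisible after composing with
    \<open>Q\<close>.\<close>
  then have Q_in: "AE t in unit_interval_measure. t \<in> {0<..<1} \<longrightarrow> Q t \<in> E"
    unfolding AE_unit_lborel by eventually_elim (auto simp: indicator_def split: if_splits)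
  have "AE t in lborel. t \<in> {0..1} \<longrightarrow> t \<in> {0<..<1::real}"
    using AE_lborel_singleton[of 0] AE_lborel_singleton[of 1] by eventually_elim auto
  then have interior: "AE t in unit_interval_measure. t \<in> {0<..<1}"
    unfolding AE_unit_interval_iff .
  show thesis
  proof
    show "positive_operator (Lp p) (Lp p) J.compose_op" "positive_operator (Lp p) (Lp p) P.compose_op"
      using p by (rule J.positive_operator_comp P.positive_operator_comp)+
    show "J.compose_op f \<in> Lp_on p E" if "f \<in> Lp p" for f
      using p that by (rule J.comp_in_Lp_on)
    show "P.compose_op (J.compose_op f) = f" for f
    proof -
      have "AE t in unit_interval_measure. t \<in> {0<..<1} \<longrightarrow>
          rep (J.compose_op f) (Q t) = indicator E (Q t) * rep f (cdf M (Q t))"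
        by (rule P.AE_comp[OF J.rep_comp]) measurable
      then show ?thesis
        unfolding L0_eq_iff using P.rep_comp[of "J.compose_op f"] Q_in interior
        by eventually_elim (simp add: FQ)
    qed
  qed
qed

section \<open>Projections onto given bands and the factorization\<close>

lemma disjoint_sum3:
  fixes a b c :: L0
  assumes "inf \<bar>a\<bar> \<bar>b\<bar> = 0" "inf \<bar>a\<bar> \<bar>c\<bar> = 0" "inf \<bar>b\<bar> \<bar>c\<bar> = 0"
  shows "AE x in unit_interval_measure. rep (a + b + c) x = rep a x + rep b x + rep c x \<and>
    (rep a x = 0 \<or> rep b x = 0) \<and> (rep a x = 0 \<or> rep c x = 0) \<and> (rep b x = 0 \<or> rep c x = 0)"
  using assms[unfolded zero_L0_iff] rep_plus[of "a + b" c] rep_plus[of a b] rep_inf[of "\<bar>a\<bar>" "\<bar>b\<bar>"]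
    rep_inf[of "\<bar>a\<bar>" "\<bar>c\<bar>"] rep_inf[of "\<bar>b\<bar>" "\<bar>c\<bar>"] rep_abs[of a] rep_abs[of b] rep_abs[of c]
  by eventually_elim (auto simp: min_def split: if_splits)

lemma disjoint_nonneg_sum3:
  fixes a b c :: L0
  assumes "inf \<bar>a\<bar> \<bar>b\<bar> = 0" "inf \<bar>a\<bar> \<bar>c\<bar> = 0" "inf \<bar>b\<bar> \<bar>c\<bar> = 0" "0 \<le> a + b + c"
  shows "0 \<le> a" "0 \<le> b" "0 \<le> c"
  unfolding nonneg_L0_iff
  using disjoint_sum3[OF assms(1-3)] assms(4)[unfolded nonneg_L0_iff]
  by (eventually_elim, auto)+

text \<open>The bands are arbitrary here, not of the form \<open>Lp_on p A\<close>. Linearity comes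
  from uniqueness of the decomposition. Positivity comes from disjointness: at almost every point at
  most one component is non-zero, so it has the sign of the sum.\<close>

lemma band_projections:
  assumes p: "0 \<le> p" and dec: "band_decomposition3 (Lp p) B1 B2 B3"
  obtains P1 P2 P3 where
    "positive_operator (Lp p) B1 P1" "positive_operator (Lp p) B2 P2" "positive_operator (Lp p) B3 P3"
    "\<And>f. f \<in> Lp p \<Longrightarrow> f = P1 f + P2 f + P3 f"
    "\<And>f g h. f \<in> B1 \<Longrightarrow> g \<in> B2 \<Longrightarrow> h \<in> B3 \<Longrightarrow>
      P1 (f + g + h) = f \<and> P2 (f + g + h) = g \<and> P3 (f + g + h) = h"
proof -
  have B: "subspace B1" "subspace B2" "subspace B3" "B1 \<subseteq> Lp p" "B2 \<subseteq> Lp p" "B3 \<subseteq> Lp p"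
    using dec by (auto simp: band_decomposition3_def band_in_def ideal_in_def)
  have ex1: "\<exists>!(f, g, h). f \<in> B1 \<and> g \<in> B2 \<and> h \<in> B3 \<and> k = f + g + h" if "k \<in> Lp p" for k
    using dec that by (simp add: band_decomposition3_def)
  define D where "D k = (THE (f, g, h). f \<in> B1 \<and> g \<in> B2 \<and> h \<in> B3 \<and> k = f + g + h)" for k
  define P1 where "P1 k = fst (D k)" for k
  define P2 where "P2 k = fst (snd (D k))" for k
  define P3 where "P3 k = snd (snd (D k))" for k
  have mem: "P1 k \<in> B1" "P2 k \<in> B2" "P3 k \<in> B3" and sum: "k = P1 k + P2 k + P3 k"
    if "k \<in> Lp p" for k
    using theI'[OF ex1[OF that]] unfolding D_def[symmetric] P1_def P2_def P3_def
    by (auto simp: case_prod_beta)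
  have uniq: "P1 k = f \<and> P2 k = g \<and> P3 k = h"
    if "f \<in> B1" "g \<in> B2" "h \<in> B3" "k = f + g + h" for f g h k
  proof -
    have "k \<in> Lp p"
      unfolding that(4) using that(1-3) B(4-6) p by (intro Lp_plus) auto
    then have "D k = (f, g, h)"
      unfolding D_def using that by (intro the1_equality ex1) auto
    then show ?thesis by (simp add: P1_def P2_def P3_def)
  qed
  have add: "P1 (k + l) = P1 k + P1 l \<and> P2 (k + l) = P2 k + P2 l \<and> P3 (k + l) = P3 k + P3 l"
    if "k \<in> Lp p" "l \<in> Lp p" for k l
  proof (rule uniq)
    have "k + l = (P1 k + P2 k + P3 k) + (P1 l + P2 l + P3 l)"
      using sum[OF that(1)] sum[OF that(2)] by metis
    then show "k + l = P1 k + P1 l + (P2 k + P2 l) + (P3 k + P3 l)"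
      by (simp add: algebra_simps)
  qed (use mem that B in \<open>auto intro: subspace_add\<close>)
  have scale: "P1 (r *\<^sub>R k) = r *\<^sub>R P1 k \<and> P2 (r *\<^sub>R k) = r *\<^sub>R P2 k \<and> P3 (r *\<^sub>R k) = r *\<^sub>R P3 k"
    if "k \<in> Lp p" for r k
  proof (rule uniq)
    show "r *\<^sub>R k = r *\<^sub>R P1 k + r *\<^sub>R P2 k + r *\<^sub>R P3 k"
      using sum[OF that(1)] by (metis scaleR_add_right)
  qed (use mem that B in \<open>auto intro: subspace_scale\<close>)
  have nonneg: "0 \<le> P1 k \<and> 0 \<le> P2 k \<and> 0 \<le> P3 k" if "k \<in> Lp p" "0 \<le> k" for k
  proof -
    have "0 \<le> P1 k + P2 k + P3 k"
      using that(2) sum[OF that(1)] by metis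
    with mem[OF that(1)] dec show ?thesis
      by (intro conjI disjoint_nonneg_sum3[of "P1 k" "P2 k" "P3 k"])
        (auto simp: band_decomposition3_def disjoint_sets_in_lattice_def)
  qed
  show thesis
  proof
    show "positive_operator (Lp p) B1 P1" "positive_operator (Lp p) B2 P2"
      "positive_operator (Lp p) B3 P3"
      unfolding positive_operator_def using mem add scale nonneg by auto
    show "k = P1 k + P2 k + P3 k" if "k \<in> Lp p" for k
      using that by (rule sum)
    show "P1 (f + g + h) = f \<and> P2 (f + g + h) = g \<and> P3 (f + g + h) = h"
      if "f \<in> B1" "g \<in> B2" "h \<in> B3" for f g h
      using that by (intro uniq) auto
  qed
qed

text \<open>\<open>N = J P3\<close> moves the third band into the second, and
  \<open>M = T P P2\<close> undoes this by \<open>P\<close> before applying \<open>T\<close>. Bands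
  are traversed only in the direction 3, 2, 1, one step per operator, so \<open>M M\<close>,
  \<open>N N\<close> and \<open>N M\<close> vanish.\<close>

lemma factorization_of_corner_operator:
  assumes p: "0 \<le> p" and T: "positive_operator (Lp p) (Lp p) T" and corner: "corner_operator p T"
  obtains M N where "positive_operator (Lp p) (Lp p) M" "positive_operator (Lp p) (Lp p) N"
    "\<And>f. f \<in> Lp p \<Longrightarrow> T f = M (N f)" "\<And>f. f \<in> Lp p \<Longrightarrow> M (M f) = 0"
    "\<And>f. f \<in> Lp p \<Longrightarrow> N (N f) = 0" "\<And>f. f \<in> Lp p \<Longrightarrow> N (M f) = 0"
proof -
  obtain B1 B2 B3 T13 where nontriv: "nontrivial_band_decomposition3 (Lp p) B1 B2 B3"
    and T13: "positive_operator B3 B1 T13"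
    and T_eq: "\<And>f1 f2 f3. f1 \<in> B1 \<Longrightarrow> f2 \<in> B2 \<Longrightarrow> f3 \<in> B3 \<Longrightarrow> T (f1 + f2 + f3) = T13 f3"
    using corner unfolding corner_operator_def by blast
  then have dec: "band_decomposition3 (Lp p) B1 B2 B3" and "B2 \<noteq> {0}"
    by (auto simp: nontrivial_band_decomposition3_def)
  have B: "subspace B1" "subspace B2" "subspace B3" "B1 \<subseteq> Lp p" "B2 \<subseteq> Lp p" "B3 \<subseteq> Lp p"
    using dec by (auto simp: band_decomposition3_def band_in_def ideal_in_def)
  have zero: "0 \<in> B1" "0 \<in> B2" "0 \<in> B3"
    using B(1-3) by (auto intro: subspace_0)
  obtain P1 P2 P3 where proj: "positive_operator (Lp p) B1 P1" "positive_operator (Lp p) B2 P2"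
      "positive_operator (Lp p) B3 P3"
    and sum: "\<And>f. f \<in> Lp p \<Longrightarrow> f = P1 f + P2 f + P3 f"
    and comp: "\<And>f g h. f \<in> B1 \<Longrightarrow> g \<in> B2 \<Longrightarrow> h \<in> B3 \<Longrightarrow>
      P1 (f + g + h) = f \<and> P2 (f + g + h) = g \<and> P3 (f + g + h) = h"
    using band_projections[OF p dec] by blast
  have mem: "P1 f \<in> B1" "P2 f \<in> B2" "P3 f \<in> B3" if "f \<in> Lp p" for f
    using proj[THEN positive_operatorD(1)] that by blast+
  have on_B1: "P2 f = 0 \<and> P3 f = 0" if "f \<in> B1" for f
    using comp[OF that zero(2,3)] by simp
  have on_B2: "P2 f = f \<and> P3 f = 0" if "f \<in> B2" for f
    using comp[OF zero(1) that zero(3)] by simp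
  have T_P3: "T f = T13 (P3 f)" if "f \<in> Lp p" for f
    using T_eq[OF mem[OF that]] sum[OF that, symmetric] by simp
  have T_B1: "T f \<in> B1" if "f \<in> Lp p" for f
    using T_P3[OF that] mem(3)[OF that] positive_operatorD(1)[OF T13] by simp
  obtain g where g: "g \<in> B2" "g \<noteq> 0"
    using \<open>B2 \<noteq> {0}\<close> zero by auto
  define E where "E = {x. rep g x \<noteq> 0}"
  have E[measurable]: "E \<in> sets borel" unfolding E_def by measurable
  have "emeasure unit_lborel E \<noteq> 0"
  proof
    assume "emeasure unit_lborel E = 0"
    then have "AE x in unit_lborel. x \<notin> E"
      using E by (intro AE_not_in null_setsI) auto
    then have "g = 0"
      unfolding zero_L0_iff AE_unit_lborel by (simp add: E_def)
    with g(2) show False ..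
  qed
  then obtain J P where J: "positive_operator (Lp p) (Lp p) J" and P: "positive_operator (Lp p) (Lp p) P"
    and J_E: "\<And>f. f \<in> Lp p \<Longrightarrow> J f \<in> Lp_on p E" and PJ: "\<And>f. f \<in> Lp p \<Longrightarrow> P (J f) = f"
    using ex_positive_embedding[OF p E] by blast
  \<comment> \<open>The outer components of \<open>f\<close> are disjoint from \<open>g\<close>,
    hence zero on \<open>E\<close>. Off \<open>E\<close> the function \<open>f\<close> is zero, and
    so is each of its pairwise disjoint components.\<close>
  have E_B2: "f \<in> B2" if f: "f \<in> Lp_on p E" for f
  proof -
    have f': "f \<in> Lp p" "AE x in unit_interval_measure. x \<notin> E \<longrightarrow> rep f x = 0"
      using f by (auto simp: Lp_on_def)
    have disj: "inf \<bar>h\<bar> \<bar>k\<bar> = 0" if "h \<in> B1 \<and> k \<in> B2 \<or> h \<in> B1 \<and> k \<in> B3 \<or> h \<in> B2 \<and> k \<in> B3" for h k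
      using dec that by (auto simp: band_decomposition3_def disjoint_sets_in_lattice_def)
    have ae: "AE x in unit_interval_measure. min \<bar>rep h x\<bar> \<bar>rep k x\<bar> = 0" if "inf \<bar>h\<bar> \<bar>k\<bar> = 0" for h k
      using that[unfolded zero_L0_iff] rep_inf[of "\<bar>h\<bar>" "\<bar>k\<bar>"] rep_abs[of h] rep_abs[of k]
      by eventually_elim simp
    note m = mem[OF f'(1)]
    have "AE x in unit_interval_measure. rep f x = rep (P1 f) x + rep (P2 f) x + rep (P3 f) x \<and>
        (rep (P1 f) x = 0 \<or> rep (P2 f) x = 0) \<and> (rep (P1 f) x = 0 \<or> rep (P3 f) x = 0) \<and>
        (rep (P2 f) x = 0 \<or> rep (P3 f) x = 0)"
      using disjoint_sum3[of "P1 f" "P2 f" "P3 f"] disj m sum[OF f'(1), symmetric] by simp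
    moreover have "AE x in unit_interval_measure. min \<bar>rep (P1 f) x\<bar> \<bar>rep g x\<bar> = 0"
      using m g by (intro ae disj) simp
    moreover have "AE x in unit_interval_measure. min \<bar>rep g x\<bar> \<bar>rep (P3 f) x\<bar> = 0"
      using m g by (intro ae disj) simp
    ultimately have "AE x in unit_interval_measure. rep (P1 f) x = 0 \<and> rep (P3 f) x = 0"
      using f'(2) by eventually_elim (auto simp: E_def min_def split: if_splits)
    then have "P1 f = 0" "P3 f = 0"
      unfolding zero_L0_iff by (auto elim: eventually_mono)
    then show "f \<in> B2" using sum[OF f'(1), symmetric] m(2) by simp
  qed
  have sub: "subspace (Lp p)" using p by (rule subspace_Lp)
  have J_B2: "J f \<in> B2" if "f \<in> Lp p" for f
    using E_B2[OF J_E[OF that]] .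
  have null: "T 0 = 0" "J 0 = 0" "P 0 = 0"
    using T J P positive_operator_zero sub by blast+
  have P2_Lp: "positive_operator (Lp p) (Lp p) P2" and P3_Lp: "positive_operator (Lp p) (Lp p) P3"
    using proj mem B positive_operator_subset by (metis order_refl subsetD)+
  have P_mem: "P f \<in> Lp p" if "f \<in> Lp p" for f using positive_operatorD(1)[OF P that] .
  show thesis
  proof
    show "positive_operator (Lp p) (Lp p) (\<lambda>f. T (P (P2 f)))"
      by (intro positive_operator_compose[OF positive_operator_compose[OF P2_Lp P] T])
    show "positive_operator (Lp p) (Lp p) (\<lambda>f. J (P3 f))"
      by (rule positive_operator_compose[OF P3_Lp J])
    fix f assume f: "f \<in> Lp p"
    have P3f: "P3 f \<in> Lp p" and P2f: "P2 f \<in> Lp p" using mem[OF f] B by auto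
    have "P3 (P3 f) = P3 f"
      using comp[OF zero(1,2) mem(3)[OF f]] by simp
    then have "T (P3 f) = T f"
      using T_P3[OF f] T_P3[OF P3f] by simp
    then show "T f = T (P (P2 (J (P3 f))))"
      using on_B2[OF J_B2[OF P3f]] PJ[OF P3f] by simp
    show "T (P (P2 (T (P (P2 f))))) = 0" "J (P3 (T (P (P2 f)))) = 0"
      using on_B1[OF T_B1[OF P_mem[OF P2f]]] null by simp_all
    show "J (P3 (J (P3 f))) = 0"
      using on_B2[OF J_B2[OF P3f]] null by simp
  qed
qed

theorem theorem3p3:
  fixes p :: real and T :: "L0 \<Rightarrow> L0"
  assumes "1 \<le> p"
    and "positive_operator (Lp p) (Lp p) T"
  defines "statement_i \<equiv>
      \<exists>M N. positive_operator (Lp p) (Lp p) M \<and> positive_operator (Lp p) (Lp p) N \<and>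
        (\<forall>f\<in>Lp p. T f = M (N f) - N (M f)) \<and>
        (\<forall>f\<in>Lp p. M (M f) = 0) \<and> (\<forall>f\<in>Lp p. N (N f) = 0)"
    and "statement_ii \<equiv>
      \<exists>M N. positive_operator (Lp p) (Lp p) M \<and> positive_operator (Lp p) (Lp p) N \<and>
        (\<forall>f\<in>Lp p. T f = M (N f)) \<and>
        (\<forall>f\<in>Lp p. M (M f) = 0) \<and> (\<forall>f\<in>Lp p. N (N f) = 0) \<and> (\<forall>f\<in>Lp p. N (M f) = 0)"
    and "statement_iii \<equiv>
      \<exists>U. positive_operator (Lp p) (Lp p) U \<and>
        (\<forall>f\<in>Lp p. T f = U (U f)) \<and> (\<forall>f\<in>Lp p. U (U (U f)) = 0)"
    and "statement_iv \<equiv>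
      \<exists>B1 B2 B3 T13. nontrivial_band_decomposition3 (Lp p) B1 B2 B3 \<and>
        positive_operator B3 B1 T13 \<and>
        (\<forall>f1\<in>B1. \<forall>f2\<in>B2. \<forall>f3\<in>B3. T (f1 + f2 + f3) = T13 f3)"
  shows "(statement_i \<longleftrightarrow> statement_ii) \<and> (statement_ii \<longleftrightarrow> statement_iii) \<and>
         (statement_iii \<longleftrightarrow> statement_iv)"
proof -
  have p0: "0 \<le> p" using assms(1) by simp
  have sub: "subspace (Lp p)" using p0 by (rule subspace_Lp)
  have iv: "statement_iv \<longleftrightarrow> corner_operator p T"
    by (simp add: statement_iv_def corner_operator_def)
  have "statement_i \<Longrightarrow> statement_iv"
    unfolding iv statement_i_def using corner_operator_of_commutator[OF assms(1,2)] by blast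
  moreover have "statement_iii \<Longrightarrow> statement_iv"
    unfolding iv statement_iii_def using corner_operator_of_square[OF assms(1,2)] by blast
  moreover have "statement_iv \<Longrightarrow> statement_ii"
    unfolding iv statement_ii_def using factorization_of_corner_operator[OF p0 assms(2)] by metis
  moreover have "statement_i \<and> statement_iii" if ii: statement_ii
  proof -
    obtain M N where M: "positive_operator (Lp p) (Lp p) M" and N: "positive_operator (Lp p) (Lp p) N"
      and T_eq: "\<And>f. f \<in> Lp p \<Longrightarrow> T f = M (N f)" and MM: "\<And>f. f \<in> Lp p \<Longrightarrow> M (M f) = 0"
      and NN: "\<And>f. f \<in> Lp p \<Longrightarrow> N (N f) = 0" and NM: "\<And>f. f \<in> Lp p \<Longrightarrow> N (M f) = 0"
      using ii unfolding statement_ii_def by blast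
    have mem: "M f \<in> Lp p" "N f \<in> Lp p" if "f \<in> Lp p" for f
      using positive_operatorD(1) M N that by blast+
    have zero: "M 0 = 0" "N 0 = 0"
      using positive_operator_zero[OF M sub] positive_operator_zero[OF N sub] by simp_all
    have statement_i
      unfolding statement_i_def using M N T_eq MM NN NM by (intro exI[of _ M] exI[of _ N]) simp
    moreover have statement_iii
      unfolding statement_iii_def
    \<comment> \<open>In the square of \<open>M + N\<close> only \<open>M N\<close> survives.
      Multiplying it once more by \<open>M\<close> or \<open>N\<close> on the left gives
      \<open>M M N\<close> or \<open>N M N\<close>, both zero.\<close>
    proof (intro exI[of _ "\<lambda>f. M f + N f"] conjI ballI)
      show "positive_operator (Lp p) (Lp p) (\<lambda>f. M f + N f)"
        by (rule positive_operator_add[OF M N sub])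
      fix f assume f: "f \<in> Lp p"
      have U2: "M (M f + N f) + N (M f + N f) = M (N f)"
        using positive_operatorD(2)[OF M mem(1)[OF f] mem(2)[OF f]]
          positive_operatorD(2)[OF N mem(1)[OF f] mem(2)[OF f]] MM NN NM f by simp
      then show "T f = M (M f + N f) + N (M f + N f)"
        using T_eq[OF f] by simp
      show "M (M (M f + N f) + N (M f + N f)) + N (M (M f + N f) + N (M f + N f)) = 0"
        unfolding U2 using MM NM mem f by simp
    qed
    ultimately show ?thesis ..
  qed
  ultimately show ?thesis by blast
qed

end
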